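(* The Feit--Thompson Theorem (every finite group of odd order is solvable) is equivalent to the following result: for $G$ a finite group of odd order, the homomorphism $H_1(E(2,G);\mathbb Z)\to H_1(B(2,G);\mathbb Z)$ induced by the projection $E(2,G)\to B(2,G)$ is not surjective.
   Context: For a finite (discrete) group $G$, $B_*(2,G)$ is the simplicial set with $B_n(2,G)=Hom(\mathbb Z^n,G)\subset G^n$, the set of $n$-tuples of pairwise commuting elements, with faces $d_0(g_1,\dots,g_n)=(g_2,\dots,g_n)$, $d_i(g_1,\dots,g_n)=(g_1,\dots,g_ig_{i+1},\dots,g_n)$ for $0<i<n$, $d_n(g_1,\dots,g_n)=(g_1,\dots,g_{n-1})$, and degeneracies $s_j$ ($0\le j\le n$) inserting $1$ after $g_j$ (at the front if $j=0$). $E_*(2,G)$ is the simplicial set with $E_n(2,G)=G\times Hom(\mathbb Z^n,G)\subset G^{n+1}$, faces $d_i(g_0,\dots,g_n)=(g_0,\dots,g_ig_{i+1},\dots,g_n)$ for $0\le i<n$, $d_n(g_0,\dots,g_n)=(g_0,\dots,g_{n-1})$, and degeneracies $s_j$ inserting $1$ after $g_j$. $B(2,G)$ and $E(2,G)$ are their geometric realizations, and the projection $E(2,G)\to B(2,G)$ is induced by forgetting $g_0$.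
   Formalization: The second statement is taken for nontrivial finite groups G of odd order: for the trivial group, of odd order 1, the homomorphism on H_1 is 0 → 0, which is surjective, so the statement as written would fail. *)

theory Defs
  imports "HOL-Homology.Homology" "HOL-Algebra.Solvable_Groups" "HOL-Analysis.Sum_Topology"
begin

section \<open>Simplicial sets\<close>

text \<open>The first argument of \<open>sface\<close> and \<open>sdegen\<close> is the degree of the simplex that the operator
  is applied to: \<open>sface X n i\<close> is $d_i \colon X_n \to X_{n-1}$ (for \<open>1 \<le> n\<close>, \<open>i \<le> n\<close>) and
  \<open>sdegen X n j\<close> is $s_j \colon X_n \to X_{n+1}$ (for \<open>j \<le> n\<close>).\<close>

record 'b sset =
  simps :: "nat \<Rightarrow> 'b set"
  sface :: "nat \<Rightarrow> nat \<Rightarrow> 'b \<Rightarrow> 'b"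
  sdegen :: "nat \<Rightarrow> nat \<Rightarrow> 'b \<Rightarrow> 'b"

locale simplicial_set =
  fixes X :: "'b sset"
  assumes face_closed:
      "\<lbrakk>x \<in> simps X (Suc n); i \<le> Suc n\<rbrakk> \<Longrightarrow> sface X (Suc n) i x \<in> simps X n"
    and degen_closed:
      "\<lbrakk>x \<in> simps X n; j \<le> n\<rbrakk> \<Longrightarrow> sdegen X n j x \<in> simps X (Suc n)"
    and face_face:
      "\<lbrakk>x \<in> simps X (Suc (Suc n)); i < j; j \<le> Suc (Suc n)\<rbrakk> \<Longrightarrow>
        sface X (Suc n) i (sface X (Suc (Suc n)) j x) =
        sface X (Suc n) (j - 1) (sface X (Suc (Suc n)) i x)"
    and face_degen_less:
      "\<lbrakk>x \<in> simps X n; i < j; j \<le> n\<rbrakk> \<Longrightarrow>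
        sface X (Suc n) i (sdegen X n j x) = sdegen X (n - 1) (j - 1) (sface X n i x)"
    and face_degen_eq:
      "\<lbrakk>x \<in> simps X n; j \<le> n; i = j \<or> i = Suc j\<rbrakk> \<Longrightarrow> sface X (Suc n) i (sdegen X n j x) = x"
    and face_degen_greater:
      "\<lbrakk>x \<in> simps X n; Suc j < i; i \<le> Suc n\<rbrakk> \<Longrightarrow>
        sface X (Suc n) i (sdegen X n j x) = sdegen X (n - 1) j (sface X n (i - 1) x)"
    and degen_degen:
      "\<lbrakk>x \<in> simps X n; i \<le> j; j \<le> n\<rbrakk> \<Longrightarrow>
        sdegen X (Suc n) i (sdegen X n j x) = sdegen X (Suc n) (Suc j) (sdegen X n i x)"

definition simplicial_map :: "'b sset \<Rightarrow> 'c sset \<Rightarrow> (nat \<Rightarrow> 'b \<Rightarrow> 'c) \<Rightarrow> bool" where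
  "simplicial_map X Y f \<longleftrightarrow>
     (\<forall>n. \<forall>x \<in> simps X n. f n x \<in> simps Y n) \<and>
     (\<forall>n. \<forall>x \<in> simps X (Suc n). \<forall>i \<le> Suc n. f n (sface X (Suc n) i x) = sface Y (Suc n) i (f (Suc n) x)) \<and>
     (\<forall>n. \<forall>x \<in> simps X n. \<forall>j \<le> n. f (Suc n) (sdegen X n j x) = sdegen Y n j (f n x))"


section \<open>Geometric realization\<close>

text \<open>The affine map $\Delta^{n+1} \to \Delta^n$ in barycentric coordinates that identifies the
  vertices \<open>j\<close> and \<open>j + 1\<close>. The companion coface map $\Delta^{n-1} \to \Delta^n$ is the library's
  \<^const>\<open>simplical_face\<close>.\<close>

definition simplicial_degen :: "nat \<Rightarrow> (nat \<Rightarrow> real) \<Rightarrow> nat \<Rightarrow> real" where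
  "simplicial_degen j t = (\<lambda>i. if i < j then t i else if i = j then t j + t (Suc j) else t (Suc i))"

text \<open>The disjoint union of $X_n \times \Delta^n$ over all \<open>n\<close>, with $X_n$ discrete; its points
  are written \<open>((n, x), t)\<close>.\<close>

definition prerealization :: "'b sset \<Rightarrow> ((nat \<times> 'b) \<times> (nat \<Rightarrow> real)) topology" where
  "prerealization X =
     sum_topology (\<lambda>(n, x). subtopology (powertop_real UNIV) (standard_simplex n))
       {(n, x). x \<in> simps X n}"

inductive_set realization_rel ::
  "'b sset \<Rightarrow> (((nat \<times> 'b) \<times> (nat \<Rightarrow> real)) \<times> ((nat \<times> 'b) \<times> (nat \<Rightarrow> real))) set"
  for X :: "'b sset" where
  face: "\<lbrakk>x \<in> simps X (Suc n); i \<le> Suc n; t \<in> standard_simplex n\<rbrakk> \<Longrightarrow>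
     (((n, sface X (Suc n) i x), t), ((Suc n, x), simplical_face i t)) \<in> realization_rel X"
| degen: "\<lbrakk>x \<in> simps X n; j \<le> n; t \<in> standard_simplex (Suc n)\<rbrakk> \<Longrightarrow>
     (((Suc n, sdegen X n j x), t), ((n, x), simplicial_degen j t)) \<in> realization_rel X"
| refl: "p \<in> topspace (prerealization X) \<Longrightarrow> (p, p) \<in> realization_rel X"
| sym: "(p, q) \<in> realization_rel X \<Longrightarrow> (q, p) \<in> realization_rel X"
| trans: "\<lbrakk>(p, q) \<in> realization_rel X; (q, r) \<in> realization_rel X\<rbrakk> \<Longrightarrow> (p, r) \<in> realization_rel X"

definition quotient_topology :: "'a topology \<Rightarrow> ('a \<times> 'a) set \<Rightarrow> 'a set topology" where
  "quotient_topology T R =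
     topology (\<lambda>U. U \<subseteq> topspace T // R \<and> openin T {p \<in> topspace T. R `` {p} \<in> U})"

definition realization :: "'b sset \<Rightarrow> ((nat \<times> 'b) \<times> (nat \<Rightarrow> real)) set topology" where
  "realization X = quotient_topology (prerealization X) (realization_rel X)"

text \<open>The map of realizations induced by \<open>f\<close> sends the class of \<open>((n, x), t)\<close> to the class of
  \<open>((n, f n x), t)\<close>; for simplicial \<open>f\<close> this does not depend on the representative, so that the
  union is over equal sets (see \<open>realization_map_class\<close> below).\<close>

definition realization_map ::
  "'c sset \<Rightarrow> (nat \<Rightarrow> 'b \<Rightarrow> 'c) \<Rightarrow>
   ((nat \<times> 'b) \<times> (nat \<Rightarrow> real)) set \<Rightarrow> ((nat \<times> 'c) \<times> (nat \<Rightarrow> real)) set" where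
  "realization_map Y f C = (\<Union>((n, x), t) \<in> C. realization_rel Y `` {((n, f n x), t)})"


section \<open>The simplicial sets \<open>B(2,G)\<close> and \<open>E(2,G)\<close>\<close>

text \<open>$Hom(\mathbb Z^n, G)$ as the set of \<open>n\<close>-tuples of pairwise commuting elements.\<close>

definition commuting_tuples :: "('a, 'm) monoid_scheme \<Rightarrow> nat \<Rightarrow> 'a list set" where
  "commuting_tuples G n =
     {gs. length gs = n \<and> set gs \<subseteq> carrier G \<and>
          (\<forall>x \<in> set gs. \<forall>y \<in> set gs. x \<otimes>\<^bsub>G\<^esub> y = y \<otimes>\<^bsub>G\<^esub> x)}"

text \<open>List positions count from 0, so \<open>mult_at G k\<close> multiplies the entries at positions \<open>k\<close> and
  \<open>k + 1\<close>, and \<open>insert_one G k\<close> inserts the unit after the first \<open>k\<close> entries.\<close>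

definition mult_at :: "('a, 'm) monoid_scheme \<Rightarrow> nat \<Rightarrow> 'a list \<Rightarrow> 'a list" where
  "mult_at G k gs = take k gs @ (gs ! k \<otimes>\<^bsub>G\<^esub> gs ! Suc k) # drop (Suc (Suc k)) gs"

definition insert_one :: "('a, 'm) monoid_scheme \<Rightarrow> nat \<Rightarrow> 'a list \<Rightarrow> 'a list" where
  "insert_one G k gs = take k gs @ \<one>\<^bsub>G\<^esub> # drop k gs"

text \<open>An \<open>n\<close>-simplex of \<open>B2 G\<close> is the list $[g_1, \dots, g_n]$ ($g_i$ at position \<open>i - 1\<close>), an
  \<open>n\<close>-simplex of \<open>E2 G\<close> is the list $[g_0, g_1, \dots, g_n]$ ($g_i$ at position \<open>i\<close>); in the
  latter $g_0$ need not commute with the other entries.\<close>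

definition B2 :: "('a, 'm) monoid_scheme \<Rightarrow> 'a list sset" where
  "B2 G = \<lparr> simps = commuting_tuples G,
            sface = (\<lambda>n i gs. if i = 0 then tl gs else if i < n then mult_at G (i - 1) gs else butlast gs),
            sdegen = (\<lambda>n j gs. insert_one G j gs) \<rparr>"

definition E2 :: "('a, 'm) monoid_scheme \<Rightarrow> 'a list sset" where
  "E2 G = \<lparr> simps = (\<lambda>n. {g # gs | g gs. g \<in> carrier G \<and> gs \<in> commuting_tuples G n}),
            sface = (\<lambda>n i gs. if i < n then mult_at G i gs else butlast gs),
            sdegen = (\<lambda>n j gs. insert_one G (Suc j) gs) \<rparr>"

definition proj2 :: "nat \<Rightarrow> 'a list \<Rightarrow> 'a list" where
  "proj2 n gs = tl gs"

definition H1_proj ::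
  "('a, 'm) monoid_scheme \<Rightarrow>
   ((nat \<times> 'a list) \<times> (nat \<Rightarrow> real)) set chain set \<Rightarrow>
   ((nat \<times> 'a list) \<times> (nat \<Rightarrow> real)) set chain set" where
  "H1_proj G =
     hom_induced 1 (realization (E2 G)) {} (realization (B2 G)) {} (realization_map (B2 G) proj2)"


section \<open>Well-definedness\<close>

lemma istopology_quotient:
  "istopology (\<lambda>U. U \<subseteq> topspace T // R \<and> openin T {p \<in> topspace T. R `` {p} \<in> U})"
  unfolding istopology_def
proof (intro conjI allI impI; (elim conjE)?)
  fix S U
  assume "openin T {p \<in> topspace T. R `` {p} \<in> S}" "openin T {p \<in> topspace T. R `` {p} \<in> U}"
  from openin_Int[OF this] show "openin T {p \<in> topspace T. R `` {p} \<in> S \<inter> U}"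
    by (rule back_subst[of "openin T"]) auto
next
  fix \<K> assume K: "\<forall>K\<in>\<K>. K \<subseteq> topspace T // R \<and> openin T {p \<in> topspace T. R `` {p} \<in> K}"
  then show "\<Union>\<K> \<subseteq> topspace T // R" by auto
  have "openin T (\<Union>K\<in>\<K>. {p \<in> topspace T. R `` {p} \<in> K})"
    using K by auto
  then show "openin T {p \<in> topspace T. R `` {p} \<in> \<Union> \<K>}"
    by (rule back_subst[of "openin T"]) auto
qed auto

lemma openin_quotient_topology:
  "openin (quotient_topology T R) U \<longleftrightarrow>
     U \<subseteq> topspace T // R \<and> openin T {p \<in> topspace T. R `` {p} \<in> U}"
  by (simp add: quotient_topology_def topology_inverse'[OF istopology_quotient])

lemma topspace_quotient_topology [simp]: "topspace (quotient_topology T R) = topspace T // R"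
proof -
  have "openin (quotient_topology T R) (topspace T // R)"
    unfolding openin_quotient_topology
    by (auto intro!: quotientI back_subst[of "openin T", OF openin_topspace])
  then show ?thesis
    by (metis openin_quotient_topology openin_subset openin_topspace subset_antisym)
qed

lemma quotient_map_quotient_topology:
  "quotient_map T (quotient_topology T R) (\<lambda>p. R `` {p})"
  unfolding quotient_map_def by (auto simp: openin_quotient_topology quotient_def)

lemma topspace_prerealization:
  "topspace (prerealization X) = {((n, x), t). x \<in> simps X n \<and> t \<in> standard_simplex n}"
  by (auto simp: prerealization_def)

lemma simplicial_degen_in_standard_simplex:
  assumes "j \<le> n" "t \<in> standard_simplex (Suc n)"
  shows "simplicial_degen j t \<in> standard_simplex n"
proof -
  have t: "\<And>i. 0 \<le> t i" "\<And>i. i > Suc n \<Longrightarrow> t i = 0" "(\<Sum>i\<le>Suc n. t i) = 1"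
    using assms by (auto simp: standard_simplex_def)
  have "(\<Sum>i\<le>n. simplicial_degen j t i) = (\<Sum>i\<le>Suc n. t i)"
    using assms(1)
  proof (induction n)
    case 0
    then show ?case by (simp add: simplicial_degen_def)
  next
    case (Suc n)
    show ?case
    proof (cases "j \<le> n")
      case True
      then show ?thesis using Suc.IH by (simp add: simplicial_degen_def)
    next
      case False
      then have "j = Suc n" using Suc.prems by simp
      then show ?thesis by (simp add: simplicial_degen_def)
    qed
  qed
  then have sum: "(\<Sum>i\<le>n. simplicial_degen j t i) = 1" using t(3) by simp
  have pos: "0 \<le> simplicial_degen j t i" for i
    using t(1) by (simp add: simplicial_degen_def)
  have zero: "simplicial_degen j t i = 0" if "i > n" for i
    using t(2) that assms(1) by (simp add: simplicial_degen_def)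
  have "simplicial_degen j t i \<le> 1" for i
  proof (cases "i \<le> n")
    case True
    then show ?thesis
      using member_le_sum[of i "{..n}" "simplicial_degen j t"] pos sum by auto
  qed (simp add: zero)
  then show ?thesis using pos zero sum by (simp add: standard_simplex_def)
qed

context simplicial_set
begin

lemma realization_rel_subset:
  "realization_rel X \<subseteq> topspace (prerealization X) \<times> topspace (prerealization X)"
proof (rule subrelI)
  fix p q assume "(p, q) \<in> realization_rel X"
  then show "(p, q) \<in> topspace (prerealization X) \<times> topspace (prerealization X)"
  proof (induction rule: realization_rel.induct)
    case (face x n i t)
    then show ?case
      using simplical_face_in_standard_simplex[of "Suc n" i t]
      by (auto simp: topspace_prerealization face_closed)
  next
    case (degen x n j t)
    then show ?case
      by (auto simp: topspace_prerealization degen_closed simplicial_degen_in_standard_simplex)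
  qed auto
qed

lemma equiv_realization_rel: "equiv (topspace (prerealization X)) (realization_rel X)"
  using realization_rel_subset
  by (auto simp: equiv_def refl_on_def sym_def trans_def
      intro: realization_rel.refl realization_rel.sym realization_rel.trans)

lemma topspace_realization:
  "topspace (realization X) = topspace (prerealization X) // realization_rel X"
  by (simp add: realization_def)

end

lemma realization_rel_map:
  assumes "simplicial_map X Y f" "(((n, x), t), ((m, y), u)) \<in> realization_rel X"
  shows "(((n, f n x), t), ((m, f m y), u)) \<in> realization_rel Y"
proof -
  define h where "h = (\<lambda>((n, x), t :: nat \<Rightarrow> real). ((n :: nat, f n x), t))"
  have "(h p, h q) \<in> realization_rel Y" if "(p, q) \<in> realization_rel X" for p q
    using that
  proof (induction rule: realization_rel.induct)
    case (face x n i t)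
    then show ?case
      using assms(1) realization_rel.face[of "f (Suc n) x" Y n i t]
      by (auto simp: h_def simplicial_map_def)
  next
    case (degen x n j t)
    then show ?case
      using assms(1) realization_rel.degen[of "f n x" Y n j t]
      by (auto simp: h_def simplicial_map_def)
  next
    case (refl p)
    then show ?case
      using assms(1)
      by (auto simp: h_def simplicial_map_def topspace_prerealization intro!: realization_rel.refl)
  qed (blast intro: realization_rel.sym realization_rel.trans)+
  from this[OF assms(2)] show ?thesis by (simp add: h_def)
qed

lemma realization_map_class:
  assumes "simplicial_map X Y f" "simplicial_set X" "simplicial_set Y"
    and "x \<in> simps X n" "t \<in> standard_simplex n"
  shows "realization_map Y f (realization_rel X `` {((n, x), t)}) = realization_rel Y `` {((n, f n x), t)}"
proof -
  have *: "realization_rel Y `` {((m, f m y), u)} = realization_rel Y `` {((n, f n x), t)}"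
    if "(((n, x), t), ((m, y), u)) \<in> realization_rel X" for m y u
    using realization_rel_map[OF assms(1) that]
      equiv_class_eq[OF simplicial_set.equiv_realization_rel[OF assms(3)]] by metis
  have "(((n, x), t), ((n, x), t)) \<in> realization_rel X"
    using assms by (auto intro!: realization_rel.refl simp: topspace_prerealization)
  then show ?thesis
    unfolding realization_map_def using * by fastforce
qed

lemma continuous_map_realization_map:
  assumes "simplicial_map X Y f" "simplicial_set X" "simplicial_set Y"
  shows "continuous_map (realization X) (realization Y) (realization_map Y f)"
proof -
  define h where "h = (\<lambda>((n, x), t :: nat \<Rightarrow> real). ((n :: nat, f n x), t))"
  let ?I = "{(n, x). x \<in> simps X n}"
  have "continuous_map (prerealization X) (prerealization Y) h"
    unfolding continuous_map_alt
  proof (intro conjI allI impI)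
    show "h \<in> topspace (prerealization X) \<rightarrow> topspace (prerealization Y)"
      using assms(1) by (auto simp: h_def topspace_prerealization simplicial_map_def)
    fix U assume U: "openin (prerealization Y) U"
    show "openin (prerealization X) (h -` U \<inter> topspace (prerealization X))"
      unfolding prerealization_def openin_sum_topology
    proof (intro conjI ballI)
      fix i assume "i \<in> ?I"
      then obtain n x where i: "i = (n, x)" "x \<in> simps X n" by auto
      then have "f n x \<in> simps Y n" using assms(1) by (auto simp: simplicial_map_def)
      then have "openin (subtopology (powertop_real UNIV) (standard_simplex n)) {t. ((n, f n x), t) \<in> U}"
        using U by (auto simp: prerealization_def openin_sum_topology)
      moreover have "{t. ((n, f n x), t) \<in> U} \<subseteq> standard_simplex n"
        using openin_subset[OF U] by (auto simp: topspace_prerealization)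
      then have "{t. ((n, f n x), t) \<in> U} = {t. (i, t) \<in> h -` U \<inter> topspace (prerealization X)}"
        using i by (auto simp: h_def topspace_prerealization)
      ultimately show "openin (case i of (n, x) \<Rightarrow> subtopology (powertop_real UNIV) (standard_simplex n))
          {xa. (i, xa) \<in> h -` U \<inter> topspace (sum_topology
            (\<lambda>(n, x). subtopology (powertop_real UNIV) (standard_simplex n)) {(n, x). x \<in> simps X n})}"
        using i by (simp add: prerealization_def)
    qed auto
  qed
  then have "continuous_map (prerealization X) (realization Y) ((\<lambda>p. realization_rel Y `` {p}) \<circ> h)"
    unfolding realization_def
    by (rule continuous_map_compose) (rule quotient_imp_continuous_map[OF quotient_map_quotient_topology])
  then have "continuous_map (prerealization X) (realization Y)
      (realization_map Y f \<circ> (\<lambda>p. realization_rel X `` {p}))"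
    by (rule continuous_map_eq)
      (auto simp: h_def topspace_prerealization realization_map_class[OF assms])
  then show ?thesis
    by (rule continuous_compose_quotient_map[OF
        quotient_map_quotient_topology[of "prerealization X" "realization_rel X", folded realization_def]])
qed


lemma length_mult_at: "Suc k < length gs \<Longrightarrow> length (mult_at G k gs) = length gs - 1"
  by (simp add: mult_at_def)

lemma nth_mult_at:
  "\<lbrakk>Suc k < length gs; i < length gs - 1\<rbrakk> \<Longrightarrow>
   mult_at G k gs ! i = (if i < k then gs ! i else if i = k then gs ! k \<otimes>\<^bsub>G\<^esub> gs ! Suc k else gs ! Suc i)"
  by (auto simp: mult_at_def nth_append nth_Cons' Suc_diff_Suc)

lemma length_insert_one: "k \<le> length gs \<Longrightarrow> length (insert_one G k gs) = Suc (length gs)"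
  by (simp add: insert_one_def)

lemma nth_insert_one:
  "\<lbrakk>k \<le> length gs; i \<le> length gs\<rbrakk> \<Longrightarrow>
   insert_one G k gs ! i = (if i < k then gs ! i else if i = k then \<one>\<^bsub>G\<^esub> else gs ! (i - 1))"
  by (auto simp: insert_one_def nth_append nth_Cons')

lemma nth_tl_Suc: "Suc i < length gs \<Longrightarrow> tl gs ! i = gs ! Suc i"
  by (simp add: nth_tl)

lemmas list_op_simps = length_mult_at nth_mult_at length_insert_one nth_insert_one nth_tl_Suc nth_butlast

context group
begin

lemma nth_carrier: "\<lbrakk>set gs \<subseteq> carrier G; i < length gs\<rbrakk> \<Longrightarrow> gs ! i \<in> carrier G"
  by (meson nth_mem subsetD)

lemma mult_at_closed: "\<lbrakk>set gs \<subseteq> carrier G; Suc k < length gs\<rbrakk> \<Longrightarrow> set (mult_at G k gs) \<subseteq> carrier G"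
  by (auto simp: mult_at_def nth_carrier dest: in_set_takeD in_set_dropD)

lemma insert_one_closed: "set gs \<subseteq> carrier G \<Longrightarrow> set (insert_one G k gs) \<subseteq> carrier G"
  by (auto simp: insert_one_def dest: in_set_takeD in_set_dropD)

lemma commute_mult:
  assumes "x \<in> carrier G" "a \<in> carrier G" "b \<in> carrier G" "x \<otimes> a = a \<otimes> x" "x \<otimes> b = b \<otimes> x"
  shows "x \<otimes> (a \<otimes> b) = (a \<otimes> b) \<otimes> x"
  using assms by (metis m_assoc)

lemma mult_at_commuting:
  assumes gs: "gs \<in> commuting_tuples G (Suc n)" and k: "k < n"
  shows "mult_at G k gs \<in> commuting_tuples G n"
proof -
  have len: "length gs = Suc n" and car: "set gs \<subseteq> carrier G"
    and com: "\<And>x y. \<lbrakk>x \<in> set gs; y \<in> set gs\<rbrakk> \<Longrightarrow> x \<otimes> y = y \<otimes> x"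
    using gs by (auto simp: commuting_tuples_def)
  let ?a = "gs ! k" and ?b = "gs ! Suc k"
  have ab: "?a \<in> set gs" "?b \<in> set gs" using len k by auto
  have sub: "set (mult_at G k gs) \<subseteq> insert (?a \<otimes> ?b) (set gs)"
    by (auto simp: mult_at_def dest: in_set_takeD in_set_dropD)
  have c: "x \<otimes> (?a \<otimes> ?b) = (?a \<otimes> ?b) \<otimes> x" if "x \<in> set gs" for x
    using that ab car com by (intro commute_mult) auto
  have "x \<otimes> y = y \<otimes> x" if "x \<in> insert (?a \<otimes> ?b) (set gs)" "y \<in> insert (?a \<otimes> ?b) (set gs)" for x y
    using that com c by auto
  then have "\<forall>x \<in> set (mult_at G k gs). \<forall>y \<in> set (mult_at G k gs). x \<otimes> y = y \<otimes> x"
    using sub by blast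
  then show ?thesis
    using mult_at_closed[OF car] len k by (simp add: commuting_tuples_def length_mult_at)
qed

lemma insert_one_commuting:
  assumes gs: "gs \<in> commuting_tuples G n" and k: "k \<le> n"
  shows "insert_one G k gs \<in> commuting_tuples G (Suc n)"
proof -
  have sub: "set (insert_one G k gs) \<subseteq> insert \<one> (set gs)"
    by (auto simp: insert_one_def dest: in_set_takeD in_set_dropD)
  have "x \<otimes> y = y \<otimes> x" if "x \<in> insert \<one> (set gs)" "y \<in> insert \<one> (set gs)" for x y
    using that gs by (auto simp: commuting_tuples_def)
  then have "\<forall>x \<in> set (insert_one G k gs). \<forall>y \<in> set (insert_one G k gs). x \<otimes> y = y \<otimes> x"
    using sub by blast
  then show ?thesis
    using gs k insert_one_closed[of gs k] by (simp add: commuting_tuples_def length_insert_one)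
qed

lemma tl_commuting: "gs \<in> commuting_tuples G (Suc n) \<Longrightarrow> tl gs \<in> commuting_tuples G n"
  by (cases gs) (auto simp: commuting_tuples_def)

lemma butlast_commuting: "gs \<in> commuting_tuples G (Suc n) \<Longrightarrow> butlast gs \<in> commuting_tuples G n"
  by (auto simp: commuting_tuples_def dest!: in_set_butlastD)

lemma B2_face_closed:
  assumes "x \<in> simps (B2 G) (Suc n)" "i \<le> Suc n"
  shows "sface (B2 G) (Suc n) i x \<in> simps (B2 G) n"
  using assms by (auto simp: B2_def tl_commuting butlast_commuting mult_at_commuting)

lemma B2_degen_closed:
  assumes "x \<in> simps (B2 G) n" "j \<le> n"
  shows "sdegen (B2 G) n j x \<in> simps (B2 G) (Suc n)"
  using assms by (auto simp: B2_def insert_one_commuting)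

lemma simps_E2:
  "gs \<in> simps (E2 G) n \<longleftrightarrow>
   length gs = Suc n \<and> set gs \<subseteq> carrier G \<and> tl gs \<in> commuting_tuples G n"
  by (cases gs) (auto simp: E2_def commuting_tuples_def)

lemma tl_mult_at: "gs \<noteq> [] \<Longrightarrow> tl (mult_at G k gs) = (if k = 0 then tl (tl gs) else mult_at G (k - 1) (tl gs))"
  by (cases k; cases gs) (auto simp: mult_at_def drop_Suc)

lemma tl_insert_one: "gs \<noteq> [] \<Longrightarrow> tl (insert_one G (Suc k) gs) = insert_one G k (tl gs)"
  by (cases gs) (auto simp: insert_one_def)

lemma simplicial_set_E2: "simplicial_set (E2 G)"
proof
  fix x :: "'a list" and n i
  assume x: "x \<in> simps (E2 G) (Suc n)" "i \<le> Suc n"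
  have "tl (sface (E2 G) (Suc n) i x) = sface (B2 G) (Suc n) i (tl x)"
    using x by (cases x) (auto simp: simps_E2 E2_def B2_def tl_mult_at butlast_tl)
  moreover have "sface (B2 G) (Suc n) i (tl x) \<in> commuting_tuples G n"
    using B2_face_closed[of "tl x" n i] x
    by (auto simp: simps_E2 B2_def)
  moreover have "length x = Suc (Suc n)" "set x \<subseteq> carrier G"
    using x by (auto simp: simps_E2)
  then have "length (sface (E2 G) (Suc n) i x) = Suc n" "set (sface (E2 G) (Suc n) i x) \<subseteq> carrier G"
    using x mult_at_closed[of x i] by (auto simp: E2_def length_mult_at dest: in_set_butlastD)
  ultimately show "sface (E2 G) (Suc n) i x \<in> simps (E2 G) n"
    by (simp add: simps_E2)
next
  fix x :: "'a list" and n j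
  assume x: "x \<in> simps (E2 G) n" "j \<le> n"
  then have l: "length x = Suc n" "set x \<subseteq> carrier G" "tl x \<in> commuting_tuples G n"
    by (auto simp: simps_E2)
  then have "x \<noteq> []" by auto
  then have "insert_one G (Suc j) x \<in> simps (E2 G) (Suc n)"
    using x l insert_one_closed[of x "Suc j"] insert_one_commuting[of "tl x" n j]
    by (simp add: simps_E2 length_insert_one tl_insert_one)
  then show "sdegen (E2 G) n j x \<in> simps (E2 G) (Suc n)"
    by (simp add: E2_def)
next
  fix x :: "'a list" and n i j :: nat
  assume x: "x \<in> simps (E2 G) (Suc (Suc n))" and ij: "i < j" "j \<le> Suc (Suc n)"
  have l: "length x = Suc (Suc (Suc n))" "set x \<subseteq> carrier G" using x by (auto simp: simps_E2)
  show "sface (E2 G) (Suc n) i (sface (E2 G) (Suc (Suc n)) j x) =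
        sface (E2 G) (Suc n) (j - 1) (sface (E2 G) (Suc (Suc n)) i x)"
  proof (cases "j = Suc i")
    case True
    then show ?thesis
      using ij l by (intro nth_equalityI)
        (auto simp: E2_def list_op_simps m_assoc nth_carrier simp del: length_greater_0_conv)
  next
    case False
    with ij have "Suc i < j" by simp
    then show ?thesis
      using ij l by (intro nth_equalityI)
        (auto simp: E2_def list_op_simps nth_carrier simp del: length_greater_0_conv)
  qed
next
  fix x :: "'a list" and n i j :: nat
  assume x: "x \<in> simps (E2 G) n" and ij: "i < j" "j \<le> n"
  have l: "length x = Suc n" "set x \<subseteq> carrier G" using x by (auto simp: simps_E2)
  show "sface (E2 G) (Suc n) i (sdegen (E2 G) n j x) = sdegen (E2 G) (n - 1) (j - 1) (sface (E2 G) n i x)"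
    using ij l by (intro nth_equalityI) (auto simp: E2_def list_op_simps nth_carrier)
next
  fix x :: "'a list" and n i j :: nat
  assume x: "x \<in> simps (E2 G) n" and ij: "j \<le> n" "i = j \<or> i = Suc j"
  have l: "length x = Suc n" "set x \<subseteq> carrier G" using x by (auto simp: simps_E2)
  consider "i = j" | "i = Suc j" "j < n" | "i = Suc n" "j = n" using ij by linarith
  then show "sface (E2 G) (Suc n) i (sdegen (E2 G) n j x) = x"
  proof cases
    case 3
    then show ?thesis using l by (simp add: E2_def insert_one_def)
  qed (use ij l in \<open>intro nth_equalityI; auto simp: E2_def list_op_simps nth_carrier\<close>)+
next
  fix x :: "'a list" and n i j :: nat
  assume x: "x \<in> simps (E2 G) n" and ij: "Suc j < i" "i \<le> Suc n"
  have l: "length x = Suc n" "set x \<subseteq> carrier G" using x by (auto simp: simps_E2)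
  show "sface (E2 G) (Suc n) i (sdegen (E2 G) n j x) = sdegen (E2 G) (n - 1) j (sface (E2 G) n (i - 1) x)"
    using ij l by (intro nth_equalityI) (auto simp: E2_def list_op_simps nth_carrier)
next
  fix x :: "'a list" and n i j :: nat
  assume x: "x \<in> simps (E2 G) n" and ij: "i \<le> j" "j \<le> n"
  have l: "length x = Suc n" using x by (auto simp: simps_E2)
  show "sdegen (E2 G) (Suc n) i (sdegen (E2 G) n j x) = sdegen (E2 G) (Suc n) (Suc j) (sdegen (E2 G) n i x)"
    using ij l by (intro nth_equalityI) (auto simp: E2_def list_op_simps)
qed

lemma simplicial_map_proj2: "simplicial_map (E2 G) (B2 G) proj2"
  unfolding simplicial_map_def
proof (intro conjI allI ballI impI)
  fix n x assume "x \<in> simps (E2 G) n"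
  then show "proj2 n x \<in> simps (B2 G) n"
    by (simp add: proj2_def simps_E2 B2_def)
next
  fix n x i assume "x \<in> simps (E2 G) (Suc n)" "i \<le> Suc n"
  then show "proj2 n (sface (E2 G) (Suc n) i x) = sface (B2 G) (Suc n) i (proj2 (Suc n) x)"
    by (cases x) (auto simp: proj2_def simps_E2 E2_def B2_def tl_mult_at butlast_tl)
next
  fix n x j assume "x \<in> simps (E2 G) n" "j \<le> n"
  then show "proj2 (Suc n) (sdegen (E2 G) n j x) = sdegen (B2 G) n j (proj2 n x)"
    by (cases x) (auto simp: proj2_def simps_E2 E2_def B2_def tl_insert_one)
qed

lemma B2_eq_proj2:
  assumes "x \<in> simps (B2 G) n"
  obtains e where "e \<in> simps (E2 G) n" "x = proj2 n e"
proof
  show "\<one> # x \<in> simps (E2 G) n" using assms by (auto simp: simps_E2 B2_def commuting_tuples_def)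
qed (simp add: proj2_def)

lemma simplicial_set_B2: "simplicial_set (B2 G)"
proof
  interpret E: simplicial_set "E2 G" by (rule simplicial_set_E2)
  have F: "\<And>n i e. \<lbrakk>e \<in> simps (E2 G) (Suc n); i \<le> Suc n\<rbrakk> \<Longrightarrow>
      sface (B2 G) (Suc n) i (proj2 (Suc n) e) = proj2 n (sface (E2 G) (Suc n) i e)"
    and D: "\<And>n j e. \<lbrakk>e \<in> simps (E2 G) n; j \<le> n\<rbrakk> \<Longrightarrow>
      sdegen (B2 G) n j (proj2 n e) = proj2 (Suc n) (sdegen (E2 G) n j e)"
    using simplicial_map_proj2 by (auto simp: simplicial_map_def)
  note FD = F D E.face_closed E.degen_closed
  {
    fix x :: "'a list" and n i j :: nat
    assume x: "x \<in> simps (B2 G) (Suc (Suc n))" and ij: "i < j" "j \<le> Suc (Suc n)"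
    obtain e where e: "e \<in> simps (E2 G) (Suc (Suc n))" "x = proj2 (Suc (Suc n)) e"
      using x by (rule B2_eq_proj2)
    show "sface (B2 G) (Suc n) i (sface (B2 G) (Suc (Suc n)) j x) =
          sface (B2 G) (Suc n) (j - 1) (sface (B2 G) (Suc (Suc n)) i x)"
      using e ij E.face_face[OF e(1) ij] by (simp add: FD)
  next
    fix x :: "'a list" and n i j :: nat
    assume x: "x \<in> simps (B2 G) n" and ij: "i < j" "j \<le> n"
    obtain e where e: "e \<in> simps (E2 G) n" "x = proj2 n e" using x by (rule B2_eq_proj2)
    obtain m where m: "n = Suc m" using ij by (cases n) auto
    show "sface (B2 G) (Suc n) i (sdegen (B2 G) n j x) = sdegen (B2 G) (n - 1) (j - 1) (sface (B2 G) n i x)"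
      using e ij E.face_degen_less[OF e(1) ij] by (simp add: FD m)
  next
    fix x :: "'a list" and n i j :: nat
    assume x: "x \<in> simps (B2 G) n" and ij: "j \<le> n" "i = j \<or> i = Suc j"
    obtain e where e: "e \<in> simps (E2 G) n" "x = proj2 n e" using x by (rule B2_eq_proj2)
    have "i \<le> Suc n" using ij by auto
    then show "sface (B2 G) (Suc n) i (sdegen (B2 G) n j x) = x"
      using e ij E.face_degen_eq[OF e(1) ij] by (simp add: FD)
  next
    fix x :: "'a list" and n i j :: nat
    assume x: "x \<in> simps (B2 G) n" and ij: "Suc j < i" "i \<le> Suc n"
    obtain e where e: "e \<in> simps (E2 G) n" "x = proj2 n e" using x by (rule B2_eq_proj2)
    obtain m where m: "n = Suc m" using ij by (cases n) auto
    show "sface (B2 G) (Suc n) i (sdegen (B2 G) n j x) = sdegen (B2 G) (n - 1) j (sface (B2 G) n (i - 1) x)"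
      using e ij E.face_degen_greater[OF e(1) ij] by (simp add: FD m)
  next
    fix x :: "'a list" and n i j :: nat
    assume x: "x \<in> simps (B2 G) n" and ij: "i \<le> j" "j \<le> n"
    obtain e where e: "e \<in> simps (E2 G) n" "x = proj2 n e" using x by (rule B2_eq_proj2)
    show "sdegen (B2 G) (Suc n) i (sdegen (B2 G) n j x) = sdegen (B2 G) (Suc n) (Suc j) (sdegen (B2 G) n i x)"
      using e ij E.degen_degen[OF e(1) ij] by (simp add: FD)
  }
qed (rule B2_face_closed B2_degen_closed; assumption)+

lemma continuous_map_proj2:
  "continuous_map (realization (E2 G)) (realization (B2 G)) (realization_map (B2 G) proj2)"
  by (intro continuous_map_realization_map simplicial_map_proj2 simplicial_set_E2 simplicial_set_B2)

end

end

theory Submission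
  imports Defs
begin

text \<open>
For a group \<open>G\<close>, the map $H_1(E(2,G)) \to H_1(B(2,G))$ is onto exactly if \<open>G\<close> is perfect. Given this,
the equivalence is elementary group theory. A nontrivial perfect group is never solvable, so if all
groups of odd order are solvable, the map is never onto. Conversely, the derived series of a finite
group of odd order stops at a perfect subgroup, which again has odd order; if the map is never
onto for a nontrivial group, that subgroup is trivial and the group is solvable.

The criterion for surjectivity rests on a covering. Left multiplication on the first coordinate is an
action of \<open>G\<close> on the simplicial set \<open>E2 G\<close> that is simply transitive on the simplices over each
simplex of \<open>B2 G\<close>. On realizations, $B(2,G)$ is therefore the quotient of the path connected
space $E(2,G)$ by a free action of \<open>G\<close> with evenly covered neighbourhoods. For every such quotient
$q \colon X \to Y$ the cokernel of $H_1(X) \to H_1(Y)$ is the abelianization of \<open>G\<close>. What is proved is the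
resulting equivalence, \<open>homology_surjective_iff_perfect\<close>, directly on singular chains and without
fundamental groups or cellular homology:

  \<^item> After enough barycentric subdivisions a chain of \<open>Y\<close> consists of simplices inside evenly covered
    sets, so it lifts to \<open>X\<close> (\<open>small_chain_lifts\<close>). Two lifts of a simplex differ by an element of \<open>G\<close>
    because simplices are connected, so the kernel of $q_\#$ is generated by the differences
    $g\sigma - \sigma$ (\<open>kernel_chain_map_induct\<close>).

  \<^item> Call a 0-chain of \<open>X\<close> a vertical boundary if it bounds a 1-chain that $q_\#$ kills. The point is
    that $gx - x$ is a vertical boundary exactly if \<open>g\<close> lies in the derived subgroup. Modulo vertical
    boundaries the class of $gx - x$ does not depend on \<open>x\<close> and is additive in \<open>g\<close>, so it vanishes on
    commutators (\<open>vertical_boundary_displacement_derived\<close>). In the other direction, the homomorphism from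
    0-chains to the abelianization that records the position of a point in its orbit kills vertical
    boundaries and sends $gx - x$ to the class of \<open>g\<close> (\<open>vertical_boundary_imp_derived\<close>).

  \<^item> If \<open>G\<close> is perfect, the lift of a small 1-cycle of \<open>Y\<close> has a vertical boundary, and subtracting a
    chain in the kernel of $q_\#$ turns it into a cycle. If the map is onto, the image of a path from
    \<open>x\<close> to $gx$ is homologous to the image of a cycle; lifting the homology shows that $gx - x$ is a
    vertical boundary.

The remaining work is to see that the action of \<open>G\<close> on the realization of \<open>E2 G\<close> has evenly covered
neighbourhoods. For this a point with simplex $(g_0, \dots, g_n)$ and barycentric coordinates
$(t_0, \dots, t_n)$ is read as the step function on the unit interval that takes the value $g_0 \cdots g_k$
on the \<open>k\<close>-th of consecutive intervals of lengths $t_0, \dots, t_n$. Faces and degeneracies only drop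
or merge intervals, so the step function is well defined on the realization. If it has the value \<open>h\<close>
on an interval \<open>I\<close>, then having the value \<open>h\<close> on more than half of \<open>I\<close> is an open condition, and no two
distinct translates of a step function can both satisfy it (\<open>move_separated\<close>).
\<close>

section \<open>Subdividing singular chains\<close>

lemma singular_chain_iterated_subdivision:
  "singular_chain p X c \<Longrightarrow> singular_chain p X ((singular_subdivision p ^^ n) c)"
  by (induction n) (auto simp: singular_chain_singular_subdivision)

lemma chain_boundary_iterated_subdivision:
  "singular_chain p X c \<Longrightarrow>
   chain_boundary p ((singular_subdivision p ^^ n) c) =
   (singular_subdivision (p - Suc 0) ^^ n) (chain_boundary p c)"
  by (induction n)
    (auto simp: chain_boundary_singular_subdivision[OF singular_chain_iterated_subdivision])

lemma iterated_subdivision_zero: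
  "singular_chain 0 X c \<Longrightarrow> (singular_subdivision 0 ^^ n) c = c"
  by (induction n) (auto simp: singular_subdivision_zero)

lemma chain_map_iterated_subdivision:
  "singular_chain p X c \<Longrightarrow>
   (singular_subdivision p ^^ n) (chain_map p f c) = chain_map p f ((singular_subdivision p ^^ n) c)"
  by (induction n)
    (auto simp: naturality_singular_subdivision[OF singular_chain_iterated_subdivision])

lemma chain_boundary_1_of:
  "chain_boundary (Suc 0) (frag_of f) =
     frag_of (singular_face (Suc 0) 0 f) - frag_of (singular_face (Suc 0) (Suc 0) f)"
  by (simp add: chain_boundary_of)

section \<open>Coverings given by free group actions\<close>

text \<open>The deck group of a normal covering. The last assumption makes \<open>q\<close> evenly covered: the translates of
  \<open>W\<close> are pairwise disjoint, and they make up the preimage of \<open>q ` W\<close>.\<close>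

locale free_quotient = group G for G (structure) +
  fixes X :: "'x topology" and Y :: "'y topology"
    and q :: "'x \<Rightarrow> 'y" and act :: "'a \<Rightarrow> 'x \<Rightarrow> 'x"
  assumes quotient: "quotient_map X Y q"
    and act_continuous: "g \<in> carrier G \<Longrightarrow> continuous_map X X (act g)"
    and act_one: "x \<in> topspace X \<Longrightarrow> act \<one> x = x"
    and act_mult: "\<lbrakk>g \<in> carrier G; h \<in> carrier G; x \<in> topspace X\<rbrakk> \<Longrightarrow>
           act (g \<otimes> h) x = act g (act h x)"
    and fibre: "\<lbrakk>x \<in> topspace X; x' \<in> topspace X\<rbrakk> \<Longrightarrow>
           q x = q x' \<longleftrightarrow> (\<exists>g \<in> carrier G. x' = act g x)"
    and separated: "x \<in> topspace X \<Longrightarrow>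
           \<exists>W. openin X W \<and> x \<in> W \<and> (\<forall>g \<in> carrier G. \<forall>w \<in> W. act g w \<in> W \<longrightarrow> g = \<one>)"
begin

lemma q_continuous: "continuous_map X Y q"
  using quotient by (rule quotient_imp_continuous_map)

lemma act_closed: "\<lbrakk>g \<in> carrier G; x \<in> topspace X\<rbrakk> \<Longrightarrow> act g x \<in> topspace X"
  using act_continuous continuous_map_image_subset_topspace by fastforce

lemma q_act: "\<lbrakk>g \<in> carrier G; x \<in> topspace X\<rbrakk> \<Longrightarrow> q (act g x) = q x"
  using fibre[of x "act g x"] act_closed by auto

lemma act_inv: "\<lbrakk>g \<in> carrier G; x \<in> topspace X\<rbrakk> \<Longrightarrow> act (inv g) (act g x) = x"
  by (metis act_mult act_one inv_closed l_inv)

lemma act_inv': "\<lbrakk>g \<in> carrier G; x \<in> topspace X\<rbrakk> \<Longrightarrow> act g (act (inv g) x) = x"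
  by (metis act_mult act_one inv_closed r_inv)

lemma act_free: 
  assumes "g \<in> carrier G" "h \<in> carrier G" "x \<in> topspace X" "act g x = act h x"
  shows "g = h"
proof -
  have "act (inv h \<otimes> g) x = x"
    using assms by (simp add: act_mult act_inv)
  then have "inv h \<otimes> g = \<one>"
    using separated[OF assms(3)] assms by (metis inv_closed m_closed)
  then show ?thesis
    using assms by (metis inv_closed inv_equality inv_inv)
qed

text \<open>The preimage of \<open>q ` W\<close> is the union of all translates of \<open>W\<close>, which is open.\<close>

lemma q_open:
  assumes "openin X W"
  shows "openin Y (q ` W)"
proof -
  have W: "W \<subseteq> topspace X" using assms by (rule openin_subset)
  have "{x \<in> topspace X. q x \<in> q ` W} = (\<Union>g \<in> carrier G. {x \<in> topspace X. act g x \<in> W})"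
  proof (intro equalityI subsetI)
    fix x assume "x \<in> {x \<in> topspace X. q x \<in> q ` W}"
    then obtain w where "x \<in> topspace X" "w \<in> W" "q x = q w" by auto
    then show "x \<in> (\<Union>g \<in> carrier G. {x \<in> topspace X. act g x \<in> W})"
      using fibre[of x w] W by auto
  next
    fix x assume "x \<in> (\<Union>g \<in> carrier G. {x \<in> topspace X. act g x \<in> W})"
    then obtain g where "g \<in> carrier G" "x \<in> topspace X" "act g x \<in> W" by auto
    then show "x \<in> {x \<in> topspace X. q x \<in> q ` W}"
      using q_act[of g x] by (metis (mono_tags, lifting) imageI mem_Collect_eq)
  qed
  moreover have "openin X {x \<in> topspace X. act g x \<in> W}" if "g \<in> carrier G" for g
    using act_continuous[OF that] assms by (rule openin_continuous_map_preimage)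
  ultimately have "openin X {x \<in> topspace X. q x \<in> q ` W}"
    by auto
  moreover have "q ` W \<subseteq> topspace Y"
    using q_continuous W by (meson continuous_map_image_subset_topspace image_mono order_trans)
  ultimately show ?thesis
    using quotient by (simp add: quotient_map_def)
qed

text \<open>The map \<open>q\<close> is open and, on a set that is disjoint from its translates, injective; its inverse there
  is the section.\<close>

lemma local_section:
  assumes "y \<in> topspace Y"
  shows "\<exists>V t. openin Y V \<and> y \<in> V \<and> continuous_map (subtopology Y V) X t \<and> (\<forall>v \<in> V. q (t v) = v)"
proof -
  obtain x where x: "x \<in> topspace X" "y = q x"
    using assms quotient by (auto simp: quotient_map_def)
  obtain W where W: "openin X W" "x \<in> W"
    and sep: "\<And>g w. \<lbrakk>g \<in> carrier G; w \<in> W; act g w \<in> W\<rbrakk> \<Longrightarrow> g = \<one>"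
    using separated[OF x(1)] by blast
  have Wsub: "W \<subseteq> topspace X" using W by (simp add: openin_subset)
  have inj: "inj_on q W"
  proof (rule inj_onI)
    fix a b assume ab: "a \<in> W" "b \<in> W" "q a = q b"
    then obtain g where "g \<in> carrier G" "b = act g a"
      using fibre[of a b] Wsub by auto
    then show "a = b" using sep[of g a] ab Wsub act_one by auto
  qed
  have op: "open_map (subtopology X W) (subtopology Y (q ` W)) q"
    unfolding open_map_def
  proof (intro allI impI)
    fix U assume "openin (subtopology X W) U"
    then have "openin X U" "U \<subseteq> W"
      using W by (auto simp: openin_open_subtopology)
    then show "openin (subtopology Y (q ` W)) (q ` U)"
      using q_open by (auto simp: openin_open_subtopology[OF q_open[OF W(1)]])
  qed
  have qY: "q ` W \<subseteq> topspace Y" using q_open[OF W(1)] by (rule openin_subset)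
  have tops: "topspace (subtopology X W) = W" "topspace (subtopology Y (q ` W)) = q ` W"
    using Wsub qY by (auto simp: inf.absorb2)
  have "continuous_map (subtopology X W) (subtopology Y (q ` W)) q"
    using q_continuous Wsub
    by (auto simp: continuous_map_in_subtopology tops intro: continuous_map_from_subtopology)
  then have "homeomorphic_map (subtopology X W) (subtopology Y (q ` W)) q"
    using op inj by (intro bijective_open_imp_homeomorphic_map) (simp_all only: tops)
  then obtain t where "homeomorphic_maps (subtopology X W) (subtopology Y (q ` W)) q t"
    using homeomorphic_map_maps by blast
  then have "continuous_map (subtopology Y (q ` W)) X t" "\<forall>v \<in> q ` W. q (t v) = v"
    unfolding homeomorphic_maps_def tops by (auto simp: continuous_map_in_subtopology)
  then show ?thesis
    using q_open[OF W(1)] W(2) x(2) by blast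
qed

text \<open>At each point the two lifts differ by a unique group element. That element is locally constant: near
  \<open>d\<close> both \<open>f'\<close> and the translate of \<open>f\<close> stay in a neighbourhood that meets no other translate of itself.\<close>

lemma lifts_differ_by_act:
  assumes "connected_space D" "continuous_map D X f" "continuous_map D X f'"
    and eq: "\<And>d. d \<in> topspace D \<Longrightarrow> q (f d) = q (f' d)"
  shows "\<exists>g \<in> carrier G. \<forall>d \<in> topspace D. f' d = act g (f d)"
proof (cases "topspace D = {}")
  case True
  then show ?thesis by auto
next
  case False
  then obtain d0 where d0: "d0 \<in> topspace D" by blast
  have fX: "\<And>d. d \<in> topspace D \<Longrightarrow> f d \<in> topspace X" "\<And>d. d \<in> topspace D \<Longrightarrow> f' d \<in> topspace X"
    using assms(2,3) continuous_map_image_subset_topspace by fastforce+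
  define A where "A = (\<lambda>g. {d \<in> topspace D. f' d = act g (f d)})"
  have opA: "openin D (A g)" if g: "g \<in> carrier G" for g
  proof (subst openin_subopen, intro ballI)
    fix d assume "d \<in> A g"
    then have d: "d \<in> topspace D" "f' d = act g (f d)" by (auto simp: A_def)
    obtain W where W: "openin X W" "f' d \<in> W"
      and sep: "\<And>g w. \<lbrakk>g \<in> carrier G; w \<in> W; act g w \<in> W\<rbrakk> \<Longrightarrow> g = \<one>"
      using separated[OF fX(2)[OF d(1)]] by blast
    have c: "continuous_map D X (act g \<circ> f)"
      using assms(2) act_continuous[OF g] by (rule continuous_map_compose)
    let ?T = "{d \<in> topspace D. f' d \<in> W} \<inter> {d \<in> topspace D. (act g \<circ> f) d \<in> W}"
    have "openin D ?T"
      using openin_continuous_map_preimage[OF assms(3) W(1)] openin_continuous_map_preimage[OF c W(1)]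
      by (rule openin_Int)
    moreover have "d \<in> ?T" using d W by auto
    moreover have "?T \<subseteq> A g"
    proof
      fix e assume e: "e \<in> ?T"
      then have eD: "e \<in> topspace D" by auto
      have "q (act g (f e)) = q (f' e)" using eq[OF eD] q_act[OF g fX(1)[OF eD]] by simp
      then obtain k where k: "k \<in> carrier G" "f' e = act k (act g (f e))"
        using fibre[of "act g (f e)" "f' e"] fX[OF eD] act_closed[OF g] by auto
      then have "k = \<one>" using e sep[of k "act g (f e)"] by auto
      then show "e \<in> A g" using k eD act_one fX act_closed[OF g] by (auto simp: A_def)
    qed
    ultimately show "\<exists>T. openin D T \<and> d \<in> T \<and> T \<subseteq> A g" by blast
  qed
  obtain g where g: "g \<in> carrier G" "f' d0 = act g (f d0)"
    using eq[OF d0] fibre fX d0 by metis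
  have cover: "topspace D - A g = (\<Union>h \<in> carrier G - {g}. A h)"
  proof (intro equalityI subsetI)
    fix d assume d: "d \<in> topspace D - A g"
    then obtain h where "h \<in> carrier G" "f' d = act h (f d)"
      using eq fibre fX by (metis DiffD1)
    then show "d \<in> (\<Union>h \<in> carrier G - {g}. A h)" using d by (auto simp: A_def)
  next
    fix d assume "d \<in> (\<Union>h \<in> carrier G - {g}. A h)"
    then obtain h where "d \<in> topspace D" "h \<in> carrier G" "h \<noteq> g" "f' d = act h (f d)"
      by (auto simp: A_def)
    then show "d \<in> topspace D - A g"
      using act_free[OF g(1) _ fX(1), of h d] by (auto simp: A_def)
  qed
  have "openin D (topspace D - A g)"
    unfolding cover using opA by blast
  then have "closedin D (A g)"
    by (auto simp: closedin_def A_def)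
  then have "A g = topspace D"
    using assms(1) opA[OF g(1)] d0 g(2) unfolding connected_space_clopen_in
    by (auto simp: A_def)
  then show ?thesis using g by (auto simp: A_def)
qed

lemma singular_simplices_differ_by_act:
  assumes f: "singular_simplex p X f" and f': "singular_simplex p X f'"
    and eq: "simplex_map p q f = simplex_map p q f'"
  shows "\<exists>g \<in> carrier G. f' = simplex_map p (act g) f"
proof -
  let ?D = "subtopology (powertop_real UNIV) (standard_simplex p)"
  have "q (f d) = q (f' d)" if "d \<in> standard_simplex p" for d
    using fun_cong[OF eq, of d] that by (simp add: simplex_map_def)
  then have "\<exists>g \<in> carrier G. \<forall>d \<in> topspace ?D. f' d = act g (f d)"
    using f f' connectedin_standard_simplex
    by (intro lifts_differ_by_act) (auto simp: singular_simplex_def connectedin_def)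
  then obtain g where "g \<in> carrier G" "\<forall>d \<in> standard_simplex p. f' d = act g (f d)"
    by auto
  then have "f' = simplex_map p (act g) f"
    using f' by (intro extensionalityI[of _ "standard_simplex p"])
      (auto simp: simplex_map_def singular_simplex_def)
  then show ?thesis using \<open>g \<in> carrier G\<close> by blast
qed

text \<open>Choosing a lift \<open>s \<tau>\<close> of each simplex that has one splits a chain \<open>c\<close> into the lift of its image,
  which is 0 for \<open>c\<close> in the kernel, and a combination of differences between simplices with the same image.\<close>

lemma kernel_chain_map_induct:
  assumes c: "singular_chain p X c" "chain_map p q c = 0"
    and P0: "P 0" and Pdiff: "\<And>a b. \<lbrakk>P a; P b\<rbrakk> \<Longrightarrow> P (a - b)"
    and P: "\<And>f g. \<lbrakk>singular_simplex p X f; g \<in> carrier G\<rbrakk> \<Longrightarrow>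
              P (frag_of (simplex_map p (act g) f) - frag_of f)"
  shows "P c"
proof -
  define s where "s = (\<lambda>\<tau>. SOME f. singular_simplex p X f \<and> simplex_map p q f = \<tau>)"
  have "P (c - frag_extend (frag_of \<circ> s) (chain_map p q c))"
    using c(1) unfolding singular_chain_def
  proof (induction rule: frag_induction)
    case (one f)
    let ?s = "s (simplex_map p q f)"
    have "singular_simplex p X ?s \<and> simplex_map p q ?s = simplex_map p q f"
      unfolding s_def by (rule someI[where x = f]) (use one in simp)
    then obtain g where "g \<in> carrier G" "f = simplex_map p (act g) ?s" "singular_simplex p X ?s"
      using singular_simplices_differ_by_act[of p ?s f] one by auto
    then show ?case using P[of ?s g] by simp
  next
    case (diff a b)
    then show ?case
      using Pdiff[OF diff] by (simp add: chain_map_diff frag_extend_diff algebra_simps)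
  qed (simp add: P0)
  then show ?thesis using c(2) by simp
qed

lemma small_chain_lifts:
  assumes c: "singular_chain p Y c"
  shows "\<exists>n c'. singular_chain p X c' \<and> chain_map p q c' = (singular_subdivision p ^^ n) c"
proof -
  define \<C> where "\<C> = {V. openin Y V \<and> (\<exists>t. continuous_map (subtopology Y V) X t \<and> (\<forall>v \<in> V. q (t v) = v))}"
  have "topspace Y \<subseteq> \<Union>\<C>"
    using local_section unfolding \<C>_def by blast
  moreover have "openin Y V" if "V \<in> \<C>" for V
    using that by (simp add: \<C>_def)
  ultimately obtain n where n: "\<And>f. f \<in> Poly_Mapping.keys ((singular_subdivision p ^^ n) c)
                      \<Longrightarrow> \<exists>V \<in> \<C>. f \<in> (standard_simplex p) \<rightarrow> V"
    using sufficient_iterated_singular_subdivision_exists[of \<C> Y p c] c by (metis order_refl)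
  let ?c = "(singular_subdivision p ^^ n) c"
  have "\<exists>c'. singular_chain p X c' \<and> chain_map p q c' = d"
    if "Poly_Mapping.keys d \<subseteq> Poly_Mapping.keys ?c" for d
    using that
  proof (induction rule: frag_induction)
    case zero
    then show ?case by (intro exI[of _ 0]) simp
  next
    case (one f)
    then obtain V t where V: "f \<in> standard_simplex p \<rightarrow> V" "continuous_map (subtopology Y V) X t"
      "\<forall>v \<in> V. q (t v) = v"
      using n[of f] one unfolding \<C>_def by blast
    have f: "singular_simplex p Y f"
      using one singular_chain_iterated_subdivision[OF c, of n] by (auto simp: singular_chain_def)
    then have fV: "singular_simplex p (subtopology Y V) f"
      using V by (auto simp: singular_simplex_subtopology)
    have "singular_simplex p X (simplex_map p t f)"
      using fV V(2) by (rule singular_simplex_simplex_map)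
    moreover have "simplex_map p q (simplex_map p t f) = f"
      using f V by (intro extensionalityI[of _ "standard_simplex p"])
        (auto simp: simplex_map_def singular_simplex_def)
    ultimately show ?case
      by (intro exI[of _ "frag_of (simplex_map p t f)"]) (simp add: singular_chain_of)
  next
    case (diff a b)
    then show ?case
      by (metis chain_map_diff singular_chain_diff)
  qed
  then show ?thesis by blast
qed

end

text \<open>Singular simplices are canonical outside the standard simplex, so the 0-simplex at a point has to be
  restricted.\<close>

definition vertex :: "'x \<Rightarrow> (nat \<Rightarrow> real) \<Rightarrow> 'x" where
  "vertex x = restrict (\<lambda>_. x) (standard_simplex 0)"

lemma singular_simplex_0_iff: "singular_simplex 0 X f \<longleftrightarrow> (\<exists>x \<in> topspace X. f = vertex x)"
proof
  assume f: "singular_simplex 0 X f"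
  let ?d = "(\<lambda>j. if j = 0 then 1 else 0) :: nat \<Rightarrow> real"
  have "f ?d \<in> topspace X"
    using f by (auto simp: singular_simplex_def continuous_map_def standard_simplex_0)
  moreover have "f = vertex (f ?d)"
    using f by (intro extensionalityI[of _ "standard_simplex 0"])
      (auto simp: singular_simplex_def vertex_def standard_simplex_0)
  ultimately show "\<exists>x \<in> topspace X. f = vertex x" by blast
qed (auto simp: singular_simplex_def vertex_def)

lemma simplex_map_vertex: "simplex_map 0 h (vertex x) = vertex (h x)"
  by (auto simp: simplex_map_def vertex_def)

lemma path_as_singular_simplex:
  assumes "path_connected_space X" "x \<in> topspace X" "y \<in> topspace X"
  shows "\<exists>\<sigma>. singular_simplex (Suc 0) X \<sigma> \<and>
             chain_boundary (Suc 0) (frag_of \<sigma>) = frag_of (vertex y) - frag_of (vertex x)"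
proof -
  obtain \<gamma> where \<gamma>: "pathin X \<gamma>" "\<gamma> 0 = x" "\<gamma> 1 = y"
    using assms unfolding path_connected_space_def by blast
  define \<sigma> where "\<sigma> = restrict (\<gamma> \<circ> (\<lambda>t. t (Suc 0))) (standard_simplex (Suc 0))"
  have "continuous_map (subtopology (powertop_real UNIV) (standard_simplex (Suc 0)))
          (subtopology euclideanreal {0..1}) (\<lambda>t. t (Suc 0))"
    by (auto simp: continuous_map_in_subtopology standard_simplex_def
        intro!: continuous_map_from_subtopology continuous_map_product_projection)
  then have "singular_simplex (Suc 0) X \<sigma>"
    using \<gamma>(1) unfolding \<sigma>_def pathin_def singular_simplex_def
    by (auto intro: continuous_map_compose)
  moreover have "singular_face (Suc 0) 0 \<sigma> = vertex y"
    "singular_face (Suc 0) (Suc 0) \<sigma> = vertex x"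
    unfolding \<sigma>_def using \<gamma>
    by (auto simp: singular_face_def vertex_def simplical_face_in_standard_simplex
        intro!: restrict_ext) (auto simp: simplical_face_def standard_simplex_0)
  ultimately show ?thesis
    by (intro exI[of _ \<sigma>]) (simp add: chain_boundary_1_of)
qed

lemma homologous_rel_iterated_subdivision:
  assumes "singular_relcycle p X S c"
  shows "homologous_rel p X S ((singular_subdivision p ^^ n) c) c"
proof (induction n)
  case (Suc n)
  have "singular_relcycle p X S ((singular_subdivision p ^^ n) c)"
    using Suc assms homologous_rel_singular_relcycle by blast
  then show ?case
    using Suc homologous_rel_singular_subdivision homologous_rel_trans by fastforce
qed simp

context free_quotient
begin

lemma simplex_map_q_act:
  assumes "singular_simplex p X f" "g \<in> carrier G"
  shows "simplex_map p q (simplex_map p (act g) f) = simplex_map p q f"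
proof -
  have "simplex_map p (q \<circ> act g) f = simplex_map p q f"
    using assms(1) by (rule simplex_map_eq) (simp add: q_act assms(2))
  then show ?thesis by (simp add: simplex_map_compose)
qed

text \<open>Under the boundary operator the kernel of $q_\#$ in degree 1 maps to the kernel in degree 0; the
  vertical boundaries are its image. The quotient is the obstruction to lifting cycles.\<close>

definition vertical_boundary :: "'x chain \<Rightarrow> bool" where
  "vertical_boundary c \<longleftrightarrow>
     (\<exists>w. singular_chain (Suc 0) X w \<and> chain_map (Suc 0) q w = 0 \<and> chain_boundary (Suc 0) w = c)"

lemma vertical_boundary_0: "vertical_boundary 0"
  unfolding vertical_boundary_def by (intro exI[of _ 0]) simp

lemma vertical_boundary_diff:
  "\<lbrakk>vertical_boundary a; vertical_boundary b\<rbrakk> \<Longrightarrow> vertical_boundary (a - b)"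
  unfolding vertical_boundary_def
  by (metis chain_boundary_diff chain_map_diff diff_zero singular_chain_diff)

lemma vertical_boundary_add:
  "\<lbrakk>vertical_boundary a; vertical_boundary b\<rbrakk> \<Longrightarrow> vertical_boundary (a + b)"
  using vertical_boundary_diff[of a "0 - b"] vertical_boundary_diff[OF vertical_boundary_0] by simp

definition displacement :: "'a \<Rightarrow> 'x \<Rightarrow> 'x chain" where
  "displacement g x = frag_of (vertex (act g x)) - frag_of (vertex x)"

text \<open>For a path $\sigma$ from \<open>x\<close> to \<open>y\<close> the chain $g\sigma - \sigma$ lies in the kernel of $q_\#$, and its
  boundary is the given difference.\<close>

lemma displacement_independent:
  assumes "path_connected_space X" "g \<in> carrier G" "x \<in> topspace X" "y \<in> topspace X"
  shows "vertical_boundary (displacement g y - displacement g x)"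
proof -
  obtain \<sigma> where \<sigma>: "singular_simplex (Suc 0) X \<sigma>"
    "chain_boundary (Suc 0) (frag_of \<sigma>) = frag_of (vertex y) - frag_of (vertex x)"
    using path_as_singular_simplex[OF assms(1,3,4)] by blast
  let ?w = "frag_of (simplex_map (Suc 0) (act g) \<sigma>) - frag_of \<sigma>"
  have "singular_chain (Suc 0) X ?w"
    using \<sigma>(1) act_continuous[OF assms(2)]
    by (intro singular_chain_diff) (auto simp: singular_chain_of singular_simplex_simplex_map)
  moreover have "chain_map (Suc 0) q ?w = 0"
    using \<sigma>(1) assms(2) by (simp add: chain_map_diff simplex_map_q_act)
  moreover have "chain_boundary (Suc 0) (frag_of (simplex_map (Suc 0) (act g) \<sigma>))
      = chain_map 0 (act g) (chain_boundary (Suc 0) (frag_of \<sigma>))"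
    using chain_boundary_chain_map[of "Suc 0" X "frag_of \<sigma>" "act g"] \<sigma>(1)
    by (simp add: singular_chain_of)
  then have "chain_boundary (Suc 0) ?w = displacement g y - displacement g x"
    by (simp add: chain_boundary_diff \<sigma>(2) chain_map_diff simplex_map_vertex displacement_def)
  ultimately show ?thesis unfolding vertical_boundary_def by blast
qed

lemma displacement_mult:
  "\<lbrakk>g \<in> carrier G; h \<in> carrier G; x \<in> topspace X\<rbrakk> \<Longrightarrow>
   displacement (g \<otimes> h) x = displacement g (act h x) + displacement h x"
  by (simp add: displacement_def act_mult)

lemma displacement_inv:
  "\<lbrakk>g \<in> carrier G; x \<in> topspace X\<rbrakk> \<Longrightarrow>
   displacement (inv g) x = 0 - displacement g (act (inv g) x)"
  by (simp add: displacement_def act_inv')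

text \<open>Modulo vertical boundaries \<open>displacement\<close> is additive in the group element and independent of the
  point. It is thus a homomorphism to an abelian group, which kills commutators.\<close>

lemma vertical_boundary_displacement_derived:
  assumes pc: "path_connected_space X" and "g \<in> derived G (carrier G)" "x \<in> topspace X"
  shows "vertical_boundary (displacement g x)"
proof -
  define S where "S = {g \<in> carrier G. \<forall>x \<in> topspace X. vertical_boundary (displacement g x)}"
  have "subgroup S G"
  proof
    show "\<one> \<in> S"
      by (simp add: S_def displacement_def act_one vertical_boundary_0)
    show "inv g \<in> S" if "g \<in> S" for g
      using that vertical_boundary_diff[OF vertical_boundary_0]
      by (auto simp: S_def displacement_inv act_closed simp del: diff_0)
    show "g \<otimes> h \<in> S" if "g \<in> S" "h \<in> S" for g h
      using that by (auto simp: S_def displacement_mult act_closed vertical_boundary_add)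
  qed (auto simp: S_def)
  moreover have "a \<otimes> b \<otimes> inv a \<otimes> inv b \<in> S" if ab: "a \<in> carrier G" "b \<in> carrier G" for a b
  proof -
    have "vertical_boundary (displacement (a \<otimes> b \<otimes> inv a \<otimes> inv b) x)" if x: "x \<in> topspace X" for x
    proof -
      let ?y = "act (inv b) x" and ?z = "act (inv a) (act (inv b) x)"
      have yz: "?y \<in> topspace X" "?z \<in> topspace X" "act b ?z \<in> topspace X"
        using ab x by (simp_all add: act_closed)
      \<comment> \<open>The displacements by \<open>inv a\<close> and \<open>inv b\<close> are negatives of displacements by \<open>a\<close> and \<open>b\<close> at other points.\<close>
      have "displacement (a \<otimes> b \<otimes> inv a \<otimes> inv b) x =
          (displacement a (act b ?z) - displacement a ?z) + (displacement b ?z - displacement b ?y)"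
        using ab x yz by (simp add: displacement_mult displacement_inv)
      then show ?thesis
        using displacement_independent[OF pc] ab yz by (simp add: vertical_boundary_add)
    qed
    then show ?thesis using ab by (simp add: S_def)
  qed
  then have "derived_set G (carrier G) \<subseteq> S" by auto
  ultimately have "derived G (carrier G) \<subseteq> S"
    unfolding derived_def by (intro generate_subgroup_incl)
  then show ?thesis using assms by (auto simp: S_def)
qed

lemma vertical_boundary_kernel:
  assumes "path_connected_space X" "derived G (carrier G) = carrier G"
    and "singular_chain 0 X c" "chain_map 0 q c = 0"
  shows "vertical_boundary c"
  using assms(3,4)
proof (rule kernel_chain_map_induct)
  fix f g assume "singular_simplex 0 X f" "g \<in> carrier G"
  then show "vertical_boundary (frag_of (simplex_map 0 (act g) f) - frag_of f)"
    using vertical_boundary_displacement_derived[OF assms(1), of g] assms(2)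
    by (auto simp: singular_simplex_0_iff simplex_map_vertex displacement_def)
qed (auto simp: vertical_boundary_0 vertical_boundary_diff)

lemma carrier_homology_1:
  "carrier (homology_group 1 Z) = homologous_rel_set (Suc 0) Z {} ` singular_relcycle_set (Suc 0) Z {}"
  using carrier_relative_homology_group[of "Suc 0" Z "{}"] by simp

lemma hom_induced_q:
  "singular_relcycle (Suc 0) X {} c \<Longrightarrow>
   hom_induced 1 X {} Y {} q (homologous_rel_set (Suc 0) X {} c) =
   homologous_rel_set (Suc 0) Y {} (chain_map (Suc 0) q c)"
  using hom_induced_chain_map[OF q_continuous, of "{}" "{}" "Suc 0" c] by simp

lemma relcycle_q:
  "singular_relcycle (Suc 0) X {} c \<Longrightarrow> singular_relcycle (Suc 0) Y {} (chain_map (Suc 0) q c)"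
  by (rule singular_relcycle_chain_map[OF _ q_continuous]) auto

lemma homology_surjective_iff_lifts:
  "hom_induced 1 X {} Y {} q ` carrier (homology_group 1 X) = carrier (homology_group 1 Y) \<longleftrightarrow>
   (\<forall>c. singular_relcycle (Suc 0) Y {} c \<longrightarrow>
      (\<exists>z. singular_relcycle (Suc 0) X {} z \<and> homologous_rel (Suc 0) Y {} (chain_map (Suc 0) q z) c))"
  (is "?l = ?r")
proof -
  let ?H = "\<lambda>c. homologous_rel_set (Suc 0) Y {} c"
  have img: "hom_induced 1 X {} Y {} q ` carrier (homology_group 1 X) =
      (\<lambda>z. ?H (chain_map (Suc 0) q z)) ` singular_relcycle_set (Suc 0) X {}"
    unfolding carrier_homology_1 image_image by (rule image_cong) (auto simp: hom_induced_q)
  have sub: "(\<lambda>z. ?H (chain_map (Suc 0) q z)) ` singular_relcycle_set (Suc 0) X {}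
      \<subseteq> ?H ` singular_relcycle_set (Suc 0) Y {}"
    using relcycle_q by blast
  have "?l \<longleftrightarrow> (\<forall>c \<in> singular_relcycle_set (Suc 0) Y {}.
      \<exists>z \<in> singular_relcycle_set (Suc 0) X {}. ?H (chain_map (Suc 0) q z) = ?H c)"
  proof -
    have "?l \<longleftrightarrow> ?H ` singular_relcycle_set (Suc 0) Y {}
        \<subseteq> (\<lambda>z. ?H (chain_map (Suc 0) q z)) ` singular_relcycle_set (Suc 0) X {}"
      unfolding img carrier_homology_1[of Y] using sub by (metis subset_antisym order_refl)
    then show ?thesis
      unfolding subset_iff image_iff Ball_def Bex_def by metis
  qed
  then show ?thesis
    unfolding homologous_rel_set_eq by blast
qed

text \<open>A subdivided cycle lifts to a chain. The boundary of the lift lies in the kernel of $q_\#$, and a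
  correction from the kernel in degree 1 removes it.\<close>

theorem perfect_imp_homology_surjective:
  assumes "path_connected_space X" "derived G (carrier G) = carrier G"
  shows "hom_induced 1 X {} Y {} q ` carrier (homology_group 1 X) = carrier (homology_group 1 Y)"
  unfolding homology_surjective_iff_lifts
proof (intro allI impI)
  fix c assume c: "singular_relcycle (Suc 0) Y {} c"
  then have cc: "singular_chain (Suc 0) Y c" "chain_boundary (Suc 0) c = 0"
    by (simp_all add: singular_cycle)
  obtain n c' where c': "singular_chain (Suc 0) X c'"
      "chain_map (Suc 0) q c' = (singular_subdivision (Suc 0) ^^ n) c"
    using small_chain_lifts[OF cc(1)] by blast
  have "chain_map 0 q (chain_boundary (Suc 0) c') = chain_boundary (Suc 0) (chain_map (Suc 0) q c')"
    using chain_boundary_chain_map[OF c'(1), of q] by simp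
  also have "\<dots> = (singular_subdivision 0 ^^ n) 0"
    unfolding c'(2) chain_boundary_iterated_subdivision[OF cc(1)] cc(2) by simp
  finally have "chain_map 0 q (chain_boundary (Suc 0) c') = 0"
    by simp
  then have "vertical_boundary (chain_boundary (Suc 0) c')"
    using assms singular_chain_boundary_alt[OF c'(1)] by (intro vertical_boundary_kernel)
  then obtain w where w: "singular_chain (Suc 0) X w" "chain_map (Suc 0) q w = 0"
      "chain_boundary (Suc 0) w = chain_boundary (Suc 0) c'"
    unfolding vertical_boundary_def by blast
  have "singular_relcycle (Suc 0) X {} (c' - w)"
    using c' w by (simp add: singular_cycle singular_chain_diff chain_boundary_diff)
  moreover have "homologous_rel (Suc 0) Y {} (chain_map (Suc 0) q (c' - w)) c"
    using homologous_rel_iterated_subdivision[OF c] by (simp add: chain_map_diff c' w)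
  ultimately show "\<exists>z. singular_relcycle (Suc 0) X {} z \<and>
      homologous_rel (Suc 0) Y {} (chain_map (Suc 0) q z) c"
    by blast
qed

text \<open>The path \<open>\<sigma>\<close> from \<open>x\<close> to \<open>act g x\<close> becomes a cycle downstairs, so it agrees with the image of a cycle
  \<open>z\<close> up to a boundary. After subdivision that boundary lifts too, and the difference \<open>k\<close> of the lifts is a
  chain in the kernel of $q_\#$. Subdivision does not change boundaries of 1-chains, so \<open>k\<close> bounds the displacement.\<close>

lemma vertical_boundary_of_surjective:
  assumes pc: "path_connected_space X"
    and surj: "hom_induced 1 X {} Y {} q ` carrier (homology_group 1 X) = carrier (homology_group 1 Y)"
    and g: "g \<in> carrier G" and x: "x \<in> topspace X"
  shows "vertical_boundary (displacement g x)"
proof -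
  obtain \<sigma> where \<sigma>: "singular_simplex (Suc 0) X \<sigma>"
    "chain_boundary (Suc 0) (frag_of \<sigma>) = displacement g x"
    using path_as_singular_simplex[OF pc x act_closed[OF g x], folded displacement_def] by (elim exE conjE)
  let ?\<gamma> = "frag_of \<sigma>"
  have \<gamma>: "singular_chain (Suc 0) X ?\<gamma>" using \<sigma> by (simp add: singular_chain_of)
  have "chain_boundary (Suc 0) (chain_map (Suc 0) q ?\<gamma>) = 0"
    using chain_boundary_chain_map[OF \<gamma>, of q] 
    unfolding \<sigma>(2) displacement_def
    by (simp add: chain_map_diff simplex_map_vertex q_act[OF g x] del: chain_map_of)
      (simp add: simplex_map_vertex q_act[OF g x])
  then have "singular_relcycle (Suc 0) Y {} (chain_map (Suc 0) q ?\<gamma>)"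
    using singular_chain_chain_map[OF \<gamma> q_continuous] by (simp add: singular_cycle)
  then obtain z where z: "singular_relcycle (Suc 0) X {} z"
    "homologous_rel (Suc 0) Y {} (chain_map (Suc 0) q ?\<gamma>) (chain_map (Suc 0) q z)"
    using surj homologous_rel_sym unfolding homology_surjective_iff_lifts by blast
  then have zc: "singular_chain (Suc 0) X z" "chain_boundary (Suc 0) z = 0"
    by (simp_all add: singular_cycle)
  obtain b where b: "singular_chain (Suc (Suc 0)) Y b"
    "chain_boundary (Suc (Suc 0)) b = chain_map (Suc 0) q (?\<gamma> - z)"
    using z(2) unfolding homologous_rel_def singular_boundary chain_map_diff by blast
  obtain n b' where b': "singular_chain (Suc (Suc 0)) X b'"
    "chain_map (Suc (Suc 0)) q b' = (singular_subdivision (Suc (Suc 0)) ^^ n) b"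
    using small_chain_lifts[OF b(1)] by blast
  let ?e = "(singular_subdivision (Suc 0) ^^ n) (?\<gamma> - z)"
  have \<gamma>z: "singular_chain (Suc 0) X (?\<gamma> - z)" using \<gamma> zc by (simp add: singular_chain_diff)
  define k where "k = ?e - chain_boundary (Suc (Suc 0)) b'"
  have "singular_chain (Suc 0) X k"
    unfolding k_def using singular_chain_iterated_subdivision[OF \<gamma>z] singular_chain_boundary_alt[OF b'(1)]
    by (rule singular_chain_diff)
  moreover have "chain_map (Suc 0) q (chain_boundary (Suc (Suc 0)) b') =
      (singular_subdivision (Suc 0) ^^ n) (chain_map (Suc 0) q (?\<gamma> - z))"
    using chain_boundary_chain_map[OF b'(1), of q] b
    by (simp add: b'(2) chain_boundary_iterated_subdivision)
  then have "chain_map (Suc 0) q k = 0"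
    by (simp only: k_def chain_map_diff[of _ _ ?e] chain_map_iterated_subdivision[OF \<gamma>z]) simp
  moreover have "chain_boundary (Suc 0) ?e = displacement g x"
    using singular_chain_boundary_alt[OF \<gamma>z] 
    by (simp add: chain_boundary_iterated_subdivision[OF \<gamma>z] iterated_subdivision_zero)
      (simp add: chain_boundary_diff \<sigma>(2) zc)
  then have "chain_boundary (Suc 0) k = displacement g x"
    unfolding k_def using chain_boundary_boundary_alt[OF b'(1)] by (simp add: chain_boundary_diff)
  ultimately show ?thesis unfolding vertical_boundary_def by blast
qed

text \<open>A choice of base points identifies each orbit with \<open>G\<close>, in general not continuously.\<close>

lemma orbit_coordinate:
  "\<exists>\<theta>. \<forall>x \<in> topspace X. \<theta> x \<in> carrier G \<and> (\<forall>g \<in> carrier G. \<theta> (act g x) = g \<otimes> \<theta> x)"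
proof -
  define s where "s = (\<lambda>y. SOME x. x \<in> topspace X \<and> q x = y)"
  have s: "s (q x) \<in> topspace X" "q (s (q x)) = q x" if "x \<in> topspace X" for x
    using someI[of "\<lambda>x'. x' \<in> topspace X \<and> q x' = q x" x] that unfolding s_def by auto
  define \<theta> where "\<theta> = (\<lambda>x. SOME g. g \<in> carrier G \<and> x = act g (s (q x)))"
  have \<theta>: "\<theta> x \<in> carrier G" "x = act (\<theta> x) (s (q x))" if x: "x \<in> topspace X" for x
  proof -
    have "\<exists>g. g \<in> carrier G \<and> x = act g (s (q x))"
      using fibre[OF s(1)[OF x] x] s(2)[OF x] by blast
    then have "\<theta> x \<in> carrier G \<and> x = act (\<theta> x) (s (q x))"
      unfolding \<theta>_def by (rule someI_ex)
    then show "\<theta> x \<in> carrier G" "x = act (\<theta> x) (s (q x))" by auto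
  qed
  have "\<theta> (act g x) = g \<otimes> \<theta> x" if x: "x \<in> topspace X" and g: "g \<in> carrier G" for g x
  proof (rule act_free)
    show "s (q x) \<in> topspace X" using x by (rule s)
    have "act (\<theta> (act g x)) (s (q x)) = act g x"
      using \<theta>(2)[OF act_closed[OF g x]] by (simp add: q_act g x)
    also have "\<dots> = act (g \<otimes> \<theta> x) (s (q x))"
      using \<theta>[OF x] s[OF x] g by (simp add: act_mult)
    finally show "act (\<theta> (act g x)) (s (q x)) = act (g \<otimes> \<theta> x) (s (q x))" .
  qed (use \<theta> act_closed g x in auto)
  then show ?thesis using \<theta> by blast
qed

text \<open>The orbit coordinate extends to a homomorphism \<open>h\<close> from 0-chains to the abelianization of \<open>G\<close>. It sends
  each displacement by \<open>k\<close> to the class of \<open>k\<close>. The boundary of $k\sigma - \sigma$ is a difference of two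
  displacements by the same \<open>k\<close>, and these chains generate the kernel of $q_\#$, so \<open>h\<close> vanishes on vertical boundaries.\<close>

lemma vertical_boundary_imp_derived:
  assumes g: "g \<in> carrier G" and x: "x \<in> topspace X"
    and vb: "vertical_boundary (displacement g x)"
  shows "g \<in> derived G (carrier G)"
proof -
  define N where "N = derived G (carrier G)"
  interpret N: normal N G unfolding N_def by (rule derived_self_is_normal)
  interpret A: comm_group "G Mod N" unfolding N_def by (rule derived_quot_is_comm_group)
  interpret pr: group_hom G "G Mod N" "\<lambda>a. N #> a"
    using N.r_coset_hom_Mod by (simp add: group_hom_def group_hom_axioms_def group_axioms A.group_axioms)
  obtain \<theta> where \<theta>: "\<And>x. x \<in> topspace X \<Longrightarrow> \<theta> x \<in> carrier G"
     "\<And>g x. \<lbrakk>x \<in> topspace X; g \<in> carrier G\<rbrakk> \<Longrightarrow> \<theta> (act g x) = g \<otimes> \<theta> x"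
    using orbit_coordinate by blast
  define \<delta> :: "nat \<Rightarrow> real" where "\<delta> = (\<lambda>j. if j = 0 then 1 else 0)"
  have \<delta>: "\<delta> \<in> standard_simplex 0" unfolding \<delta>_def by simp
  have "(\<lambda>f. N #> \<theta> (f \<delta>)) ` singular_simplex_set 0 X \<subseteq> carrier (G Mod N)"
    using \<theta>(1) \<delta> by (auto simp: singular_simplex_0_iff vertex_def intro!: pr.hom_closed)
  then obtain h where h: "h \<in> hom (chain_group 0 X) (G Mod N)"
    and hf: "\<And>f. f \<in> singular_simplex_set 0 X \<Longrightarrow> h (frag_of f) = N #> \<theta> (f \<delta>)"
    unfolding chain_group_def by (rule A.free_Abelian_group_universal) blast
  interpret h: group_hom "chain_group 0 X" "G Mod N" h
    using h by (simp add: group_hom_def group_hom_axioms_def A.group_axioms)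
  have hv: "h (frag_of (vertex x)) = N #> \<theta> x" if "x \<in> topspace X" for x
    using hf[of "vertex x"] that \<delta> by (auto simp: singular_simplex_0_iff vertex_def)
  have h_diff: "h (a - b) = h a \<otimes>\<^bsub>G Mod N\<^esub> inv\<^bsub>G Mod N\<^esub> h b"
    if "singular_chain 0 X a" "singular_chain 0 X b" for a b
    using h.hom_mult[of a "- b"] h.hom_inv[of b] that
    by (simp add: singular_chain_minus singular_chain_def)
  have cv: "singular_chain 0 X (frag_of (vertex x))" if "x \<in> topspace X" for x
    using that by (auto simp: singular_chain_of singular_simplex_0_iff)
  have cd: "singular_chain 0 X (displacement g x)" if "x \<in> topspace X" "g \<in> carrier G" for g x
    unfolding displacement_def using that by (intro singular_chain_diff cv act_closed)
  have hd: "h (displacement g x) = N #> g" if "x \<in> topspace X" "g \<in> carrier G" for g x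
  proof -
    have "N #> \<theta> x \<in> carrier (G Mod N)" "N #> g \<in> carrier (G Mod N)"
      using that \<theta>(1) by (auto intro: pr.hom_closed)
    moreover have "h (displacement g x) =
        (N #> g) \<otimes>\<^bsub>G Mod N\<^esub> (N #> \<theta> x) \<otimes>\<^bsub>G Mod N\<^esub> inv\<^bsub>G Mod N\<^esub> (N #> \<theta> x)"
      unfolding displacement_def using that \<theta>
      by (simp add: h_diff cv hv act_closed del: mult_FactGroup)
    ultimately show ?thesis
      by (simp add: A.m_assoc del: mult_FactGroup one_FactGroup)
  qed
  obtain w where w: "singular_chain (Suc 0) X w" "chain_map (Suc 0) q w = 0"
    "chain_boundary (Suc 0) w = displacement g x"
    using vb unfolding vertical_boundary_def by blast
  have "singular_chain (Suc 0) X w \<and> h (chain_boundary (Suc 0) w) = \<one>\<^bsub>G Mod N\<^esub>"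
    using w(1,2)
  proof (rule kernel_chain_map_induct)
    show "singular_chain (Suc 0) X 0 \<and> h (chain_boundary (Suc 0) 0) = \<one>\<^bsub>G Mod N\<^esub>"
      using h.hom_one by simp
  next
    fix a b
    assume "singular_chain (Suc 0) X a \<and> h (chain_boundary (Suc 0) a) = \<one>\<^bsub>G Mod N\<^esub>"
      "singular_chain (Suc 0) X b \<and> h (chain_boundary (Suc 0) b) = \<one>\<^bsub>G Mod N\<^esub>"
    then show "singular_chain (Suc 0) X (a - b) \<and> h (chain_boundary (Suc 0) (a - b)) = \<one>\<^bsub>G Mod N\<^esub>"
      by (simp add: chain_boundary_diff h_diff singular_chain_boundary_alt singular_chain_diff
          del: one_FactGroup mult_FactGroup)
  next
    fix f k assume f: "singular_simplex (Suc 0) X f" and k: "k \<in> carrier G"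
    have fc: "singular_chain (Suc 0) X (frag_of f)" using f by (simp add: singular_chain_of)
    have kf: "singular_chain (Suc 0) X (frag_of (simplex_map (Suc 0) (act k) f))"
      using f act_continuous[OF k] by (simp add: singular_chain_of singular_simplex_simplex_map)
    have "singular_simplex 0 X (singular_face (Suc 0) i f)" if "i \<le> Suc 0" for i
      using singular_simplex_singular_face[OF f, of i] that by simp
    then obtain u v where uv: "u \<in> topspace X" "v \<in> topspace X"
      "singular_face (Suc 0) 0 f = vertex u" "singular_face (Suc 0) (Suc 0) f = vertex v"
      by (metis singular_simplex_0_iff order_refl le0)
    have "chain_boundary (Suc 0) (frag_of (simplex_map (Suc 0) (act k) f))
        = chain_map 0 (act k) (chain_boundary (Suc 0) (frag_of f))"
      using chain_boundary_chain_map[OF fc, of "act k"] by simp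
    then have "chain_boundary (Suc 0) (frag_of (simplex_map (Suc 0) (act k) f) - frag_of f)
      = displacement k u - displacement k v"
      by (simp add: chain_boundary_diff chain_boundary_1_of uv chain_map_diff simplex_map_vertex
          displacement_def)
    then show "singular_chain (Suc 0) X (frag_of (simplex_map (Suc 0) (act k) f) - frag_of f) \<and>
       h (chain_boundary (Suc 0) (frag_of (simplex_map (Suc 0) (act k) f) - frag_of f)) = \<one>\<^bsub>G Mod N\<^esub>"
      using uv k pr.hom_closed[OF k] by (simp add: h_diff cd hd singular_chain_diff fc kf del: one_FactGroup mult_FactGroup)
  qed
  then have "N #> g = N"
    using w(3) hd[OF x g] by simp
  then show ?thesis
    using rcos_self[OF g N.subgroup_axioms] by (simp add: N_def)
qed

theorem homology_surjective_iff_perfect: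
  assumes "path_connected_space X" "topspace X \<noteq> {}"
  shows "hom_induced 1 X {} Y {} q ` carrier (homology_group 1 X) = carrier (homology_group 1 Y) \<longleftrightarrow>
         derived G (carrier G) = carrier G"
proof
  assume surj: "hom_induced 1 X {} Y {} q ` carrier (homology_group 1 X) = carrier (homology_group 1 Y)"
  obtain x where "x \<in> topspace X" using assms(2) by blast
  then have "carrier G \<subseteq> derived G (carrier G)"
    using vertical_boundary_imp_derived vertical_boundary_of_surjective[OF assms(1) surj] by blast
  then show "derived G (carrier G) = carrier G"
    using derived_in_carrier by blast
qed (rule perfect_imp_homology_surjective[OF assms(1)])

end

section \<open>Geometric realizations\<close>

abbreviation cell_point :: "'b sset \<Rightarrow> nat \<Rightarrow> 'b \<Rightarrow> (nat \<Rightarrow> real) \<Rightarrow> ((nat \<times> 'b) \<times> (nat \<Rightarrow> real)) set" where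
  "cell_point X n x t \<equiv> realization_rel X `` {((n, x), t)}"

lemma openin_prerealization:
  "openin (prerealization X) U \<longleftrightarrow>
     U \<subseteq> topspace (prerealization X) \<and>
     (\<forall>n. \<forall>x \<in> simps X n. openin (subtopology (powertop_real UNIV) (standard_simplex n)) {t. ((n, x), t) \<in> U})"
  unfolding prerealization_def openin_sum_topology by auto

lemma realization_quotient_map:
  "quotient_map (prerealization X) (realization X) (\<lambda>p. realization_rel X `` {p})"
  unfolding realization_def by (rule quotient_map_quotient_topology)

lemma continuous_map_cell_point:
  assumes "x \<in> simps X n"
  shows "continuous_map (subtopology (powertop_real UNIV) (standard_simplex n)) (realization X) (cell_point X n x)"
proof -
  have "continuous_map (subtopology (powertop_real UNIV) (standard_simplex n)) (prerealization X) (\<lambda>t. ((n, x), t))"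
    using continuous_map_component_injection[of "(n, x)" "{(n, x). x \<in> simps X n}"
        "\<lambda>(n, x). subtopology (powertop_real UNIV) (standard_simplex n)"] assms
    by (simp add: prerealization_def)
  from continuous_map_compose[OF this quotient_imp_continuous_map[OF realization_quotient_map]]
  show ?thesis by (simp add: o_def)
qed

context simplicial_set
begin

lemma cell_point_in_realization:
  "\<lbrakk>x \<in> simps X n; t \<in> standard_simplex n\<rbrakk> \<Longrightarrow> cell_point X n x t \<in> topspace (realization X)"
  unfolding topspace_realization by (rule quotientI) (simp add: topspace_prerealization)

lemma realization_cases:
  assumes "C \<in> topspace (realization X)"
  obtains n x t where "x \<in> simps X n" "t \<in> standard_simplex n" "C = cell_point X n x t"
proof -
  obtain p where "p \<in> topspace (prerealization X)" "C = realization_rel X `` {p}"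
    using assms unfolding topspace_realization by (rule quotientE)
  then show thesis
    using that by (cases p) (auto simp: topspace_prerealization)
qed

lemma cell_point_eq_iff:
  assumes "x \<in> simps X n" "t \<in> standard_simplex n"
  shows "cell_point X n x t = cell_point X m y u \<longleftrightarrow> (((n, x), t), ((m, y), u)) \<in> realization_rel X"
proof
  assume "(((n, x), t), ((m, y), u)) \<in> realization_rel X"
  then show "cell_point X n x t = cell_point X m y u"
    using equiv_realization_rel by (rule equiv_class_eq[rotated])
next
  assume eq: "cell_point X n x t = cell_point X m y u"
  have "((n, x), t) \<in> cell_point X n x t"
    using assms by (auto intro: realization_rel.refl simp: topspace_prerealization)
  then show "(((n, x), t), ((m, y), u)) \<in> realization_rel X"
    unfolding eq by (auto intro: realization_rel.sym)
qed

lemma cell_point_face: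
  assumes "x \<in> simps X (Suc n)" "i \<le> Suc n" "t \<in> standard_simplex n"
  shows "cell_point X n (sface X (Suc n) i x) t = cell_point X (Suc n) x (simplical_face i t)"
  using realization_rel.face[OF assms] cell_point_eq_iff[OF face_closed[OF assms(1,2)] assms(3)] by simp

text \<open>A function on the disjoint union of the simplices that respects the identifications descends to the
  realization, where its superlevel sets are open. The descended function is expressed through an arbitrary
  representative.\<close>

lemma openin_realization_superlevel:
  fixes \<phi> :: "(nat \<times> 'b) \<times> (nat \<Rightarrow> real) \<Rightarrow> real"
  assumes inv: "\<And>p p'. (p, p') \<in> realization_rel X \<Longrightarrow> \<phi> p = \<phi> p'"
    and cont: "\<And>n x. x \<in> simps X n \<Longrightarrow>
       continuous_map (subtopology (powertop_real UNIV) (standard_simplex n)) euclideanreal (\<lambda>t. \<phi> ((n, x), t))"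
  shows "openin (realization X) {C \<in> topspace (realization X). \<exists>p \<in> C. r < \<phi> p}"
proof -
  let ?W = "{C \<in> topspace (realization X). \<exists>p \<in> C. r < \<phi> p}"
  have "{p \<in> topspace (prerealization X). realization_rel X `` {p} \<in> ?W}
      = {p \<in> topspace (prerealization X). r < \<phi> p}"
  proof (rule Collect_cong, rule conj_cong[OF HOL.refl])
    fix p assume p: "p \<in> topspace (prerealization X)"
    then have "realization_rel X `` {p} \<in> topspace (realization X)" "(p, p) \<in> realization_rel X"
      by (auto simp: topspace_realization intro: quotientI realization_rel.refl)
    moreover have "r < \<phi> p" if "p' \<in> realization_rel X `` {p}" "r < \<phi> p'" for p'
      using that inv[of p p'] by simp
    ultimately show "realization_rel X `` {p} \<in> ?W \<longleftrightarrow> r < \<phi> p"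
      by blast
  qed
  moreover have "openin (prerealization X) {p \<in> topspace (prerealization X). r < \<phi> p}"
    unfolding openin_prerealization
  proof (intro conjI allI ballI)
    fix n x assume x: "x \<in> simps X n"
    have "openin (subtopology (powertop_real UNIV) (standard_simplex n))
        {t \<in> topspace (subtopology (powertop_real UNIV) (standard_simplex n)). \<phi> ((n, x), t) \<in> {r<..}}"
      by (rule openin_continuous_map_preimage[OF cont[OF x]]) simp
    then show "openin (subtopology (powertop_real UNIV) (standard_simplex n))
        {t. ((n, x), t) \<in> {p \<in> topspace (prerealization X). r < \<phi> p}}"
      using x by (simp add: topspace_prerealization)
  qed auto
  ultimately show ?thesis
    by (auto simp: realization_def openin_quotient_topology)
qed

lemma path_connectedin_cell:
  "x \<in> simps X n \<Longrightarrow> path_connectedin (realization X) (cell_point X n x ` standard_simplex n)"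
  by (rule path_connectedin_continuous_map_image[OF continuous_map_cell_point])
    (simp_all add: path_connectedin_subtopology path_connectedin_standard_simplex)

lemma path_component_cell:
  "\<lbrakk>x \<in> simps X n; s \<in> standard_simplex n; t \<in> standard_simplex n\<rbrakk> \<Longrightarrow>
   path_component_of (realization X) (cell_point X n x s) (cell_point X n x t)"
  using path_connectedin_cell[of x n] unfolding path_component_of by blast

lemma path_component_face:
  assumes "x \<in> simps X (Suc n)" "i \<le> Suc n" "s \<in> standard_simplex (Suc n)" "t \<in> standard_simplex n"
  shows "path_component_of (realization X) (cell_point X (Suc n) x s) (cell_point X n (sface X (Suc n) i x) t)"
  using path_component_cell[OF assms(1,3), of "simplical_face i t"] assms
    simplical_face_in_standard_simplex[of "Suc n" i t] by (simp add: cell_point_face)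

end

text \<open>A set in the realization is open if it is open in every simplex, and the simplex of \<open>y\<close> in the
  realization of \<open>Y\<close> receives that of any preimage \<open>x\<close> by the identity on coordinates.\<close>

lemma quotient_map_realization_map:
  assumes f: "simplicial_map X Y f" and X: "simplicial_set X" and Y: "simplicial_set Y"
    and surj: "\<And>n y. y \<in> simps Y n \<Longrightarrow> \<exists>x \<in> simps X n. f n x = y"
  shows "quotient_map (realization X) (realization Y) (realization_map Y f)"
  unfolding quotient_map_def
proof (intro conjI allI impI)
  interpret X: simplicial_set X by fact
  interpret Y: simplicial_set Y by fact
  have fX: "f n x \<in> simps Y n" if "x \<in> simps X n" for n x
    using f that by (simp add: simplicial_map_def)
  have cont: "continuous_map (realization X) (realization Y) (realization_map Y f)"
    using f X Y by (rule continuous_map_realization_map)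
  have map: "realization_map Y f (cell_point X n x t) = cell_point Y n (f n x) t"
    if "x \<in> simps X n" "t \<in> standard_simplex n" for n x t
    using f X Y that by (rule realization_map_class)
  show "realization_map Y f ` topspace (realization X) = topspace (realization Y)"
  proof (intro equalityI subsetI)
    fix C assume "C \<in> topspace (realization Y)"
    then obtain n y t where y: "y \<in> simps Y n" "t \<in> standard_simplex n" "C = cell_point Y n y t"
      by (rule Y.realization_cases)
    then obtain x where "x \<in> simps X n" "f n x = y" using surj by blast
    then show "C \<in> realization_map Y f ` topspace (realization X)"
      using y map X.cell_point_in_realization by (metis image_eqI)
  qed (use cont in \<open>auto simp: continuous_map_def\<close>)
  fix U assume U: "U \<subseteq> topspace (realization Y)"
  show "openin (realization X) {x \<in> topspace (realization X). realization_map Y f x \<in> U} = openin (realization Y) U"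
  proof
    assume "openin (realization X) {x \<in> topspace (realization X). realization_map Y f x \<in> U}"
    then have op: "openin (prerealization X) {p \<in> topspace (prerealization X). realization_rel X `` {p}
         \<in> {x \<in> topspace (realization X). realization_map Y f x \<in> U}}"
      by (simp add: realization_def openin_quotient_topology)
    have "openin (subtopology (powertop_real UNIV) (standard_simplex n))
        {t. ((n, y), t) \<in> topspace (prerealization Y) \<and> cell_point Y n y t \<in> U}"
      if y: "y \<in> simps Y n" for n y
    proof -
      obtain x where x: "x \<in> simps X n" "f n x = y" using surj y by blast
      have "openin (subtopology (powertop_real UNIV) (standard_simplex n))
         {t. ((n, x), t) \<in> {p \<in> topspace (prerealization X). realization_rel X `` {p}
              \<in> {x \<in> topspace (realization X). realization_map Y f x \<in> U}}}"
        using op x unfolding openin_prerealization by blast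
      also have "{t. ((n, x), t) \<in> {p \<in> topspace (prerealization X). realization_rel X `` {p}
              \<in> {x \<in> topspace (realization X). realization_map Y f x \<in> U}}}
          = {t. ((n, y), t) \<in> topspace (prerealization Y) \<and> cell_point Y n y t \<in> U}"
        using x y map X.cell_point_in_realization by (auto simp: topspace_prerealization)
      finally show ?thesis .
    qed
    then have "openin (prerealization Y) {p \<in> topspace (prerealization Y). realization_rel Y `` {p} \<in> U}"
      unfolding openin_prerealization by auto
    then show "openin (realization Y) U"
      using U by (simp add: realization_def openin_quotient_topology)
  qed (use cont in \<open>rule openin_continuous_map_preimage\<close>)
qed

section \<open>The translation action on the simplices of $E(2,G)$\<close>

definition translate :: "('a, 'm) monoid_scheme \<Rightarrow> 'a \<Rightarrow> nat \<Rightarrow> 'a list \<Rightarrow> 'a list" where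
  "translate G g n xs = (g \<otimes>\<^bsub>G\<^esub> hd xs) # tl xs"

context group
begin

lemma E2_cases:
  assumes "xs \<in> simps (E2 G) n"
  obtains a as where "xs = a # as" "a \<in> carrier G" "as \<in> commuting_tuples G n" "length as = n" "set as \<subseteq> carrier G"
  using assms by (auto simp: E2_def commuting_tuples_def)

lemma translate_closed:
  "\<lbrakk>g \<in> carrier G; xs \<in> simps (E2 G) n\<rbrakk> \<Longrightarrow> translate G g n xs \<in> simps (E2 G) n"
  by (auto simp: E2_def translate_def)

lemma simplicial_map_translate:
  assumes g: "g \<in> carrier G"
  shows "simplicial_map (E2 G) (E2 G) (translate G g)"
  unfolding simplicial_map_def
proof (intro conjI allI ballI impI)
  fix n x assume "x \<in> simps (E2 G) n"
  then show "translate G g n x \<in> simps (E2 G) n" using g by (rule translate_closed[rotated])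
next
  fix n x i assume x: "x \<in> simps (E2 G) (Suc n)" "i \<le> Suc n"
  then obtain a b as where "x = a # b # as" "a \<in> carrier G" "b \<in> carrier G"
    by (elim E2_cases) (auto simp: length_Suc_conv)
  then show "translate G g n (sface (E2 G) (Suc n) i x) = sface (E2 G) (Suc n) i (translate G g (Suc n) x)"
    using g by (cases i) (auto simp: E2_def translate_def mult_at_def m_assoc)
next
  fix n x j assume x: "x \<in> simps (E2 G) n" "j \<le> n"
  then show "translate G g (Suc n) (sdegen (E2 G) n j x) = sdegen (E2 G) n j (translate G g n x)"
    by (elim E2_cases) (auto simp: E2_def translate_def insert_one_def)
qed

lemma translate_one: "xs \<in> simps (E2 G) n \<Longrightarrow> translate G \<one> n xs = xs"
  by (elim E2_cases) (simp add: translate_def)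

lemma translate_mult:
  "\<lbrakk>g \<in> carrier G; h \<in> carrier G; xs \<in> simps (E2 G) n\<rbrakk> \<Longrightarrow>
   translate G (g \<otimes> h) n xs = translate G g n (translate G h n xs)"
  by (elim E2_cases) (simp add: translate_def m_assoc)

lemma translate_transitive:
  assumes "xs \<in> simps (E2 G) n" "ys \<in> simps (E2 G) n" "tl xs = tl ys"
  obtains g where "g \<in> carrier G" "ys = translate G g n xs"
proof -
  obtain a b as where "xs = a # as" "ys = b # as" "a \<in> carrier G" "b \<in> carrier G"
    using assms by (elim E2_cases) auto
  then show thesis
    by (intro that[of "b \<otimes> inv a"]) (auto simp: translate_def m_assoc)
qed

lemma proj2_translate: "proj2 n (translate G g n xs) = proj2 n xs"
  by (simp add: proj2_def translate_def)

definition forget_first :: "(nat \<times> 'a list) \<times> (nat \<Rightarrow> real) \<Rightarrow> (nat \<times> 'a list) \<times> (nat \<Rightarrow> real)" where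
  "forget_first = (\<lambda>((n, xs), t). ((n, proj2 n xs), t))"

text \<open>Here \<open>op\<close> is a face or degeneracy operator upstairs and \<open>op'\<close> the one below it. Any lift of \<open>x\<close> is
  mapped to some lift of \<open>op' x\<close>; a translation moves it to the prescribed lift \<open>xs\<close>.\<close>

lemma lift_by_translation:
  assumes map: "\<And>zs. zs \<in> simps (E2 G) m \<Longrightarrow> op zs \<in> simps (E2 G) n \<and> proj2 n (op zs) = op' (proj2 m zs)"
    and equiv: "\<And>g zs. \<lbrakk>g \<in> carrier G; zs \<in> simps (E2 G) m\<rbrakk> \<Longrightarrow>
        translate G g n (op zs) = op (translate G g m zs)"
    and x: "x \<in> simps (B2 G) m" and xs: "xs \<in> simps (E2 G) n" "proj2 n xs = op' x"
  obtains ys where "ys \<in> simps (E2 G) m" "proj2 m ys = x" "op ys = xs"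
proof -
  obtain zs where zs: "zs \<in> simps (E2 G) m" "x = proj2 m zs"
    using x by (rule B2_eq_proj2)
  have "tl (op zs) = tl xs"
    using map[OF zs(1)] zs(2) xs(2) by (simp add: proj2_def)
  then obtain g where g: "g \<in> carrier G" "xs = translate G g n (op zs)"
    using translate_transitive[of "op zs" n xs] xs(1) map[OF zs(1)] by blast
  show thesis
    using that[of "translate G g m zs"] g zs equiv by (simp add: proj2_translate translate_closed)
qed

text \<open>Identifications of points of $B(2,G)$ lift with prescribed start, as in a covering. Both directions are
  proved at once because the relation is closed under symmetry.\<close>

lemma realization_rel_lift:
  assumes "(p, p') \<in> realization_rel (B2 G)"
  shows "(\<forall>e \<in> topspace (prerealization (E2 G)). forget_first e = p \<longrightarrow>
            (\<exists>e'. forget_first e' = p' \<and> (e, e') \<in> realization_rel (E2 G))) \<and>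
         (\<forall>e' \<in> topspace (prerealization (E2 G)). forget_first e' = p' \<longrightarrow>
            (\<exists>e. forget_first e = p \<and> (e, e') \<in> realization_rel (E2 G)))"
    (is "?P p p' \<and> ?Q p p'")
  using assms
proof (induction rule: realization_rel.induct)
  case (face x n i t)
  interpret E: simplicial_set "E2 G" by (rule simplicial_set_E2)
  let ?d = "sface (E2 G) (Suc n) i" and ?d' = "sface (B2 G) (Suc n) i"
  have d: "?d zs \<in> simps (E2 G) n \<and> proj2 n (?d zs) = ?d' (proj2 (Suc n) zs)"
    if "zs \<in> simps (E2 G) (Suc n)" for zs
    using simplicial_map_proj2 E.face_closed that face by (simp add: simplicial_map_def)
  have eq: "translate G g n (?d zs) = ?d (translate G g (Suc n) zs)"
    if "g \<in> carrier G" "zs \<in> simps (E2 G) (Suc n)" for g zs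
    using simplicial_map_translate that face by (simp add: simplicial_map_def)
  show ?case
  proof (intro conjI ballI impI)
    fix e assume e: "e \<in> topspace (prerealization (E2 G))" "forget_first e = ((n, ?d' x), t)"
    then obtain xs where xs: "e = ((n, xs), t)" "xs \<in> simps (E2 G) n" "proj2 n xs = ?d' x"
      by (cases e) (auto simp: forget_first_def topspace_prerealization)
    obtain ys where ys: "ys \<in> simps (E2 G) (Suc n)" "proj2 (Suc n) ys = x" "?d ys = xs"
      by (rule lift_by_translation[of "Suc n" ?d n ?d', OF d eq face(1) xs(2,3)])
    then show "\<exists>e'. forget_first e' = ((Suc n, x), simplical_face i t) \<and> (e, e') \<in> realization_rel (E2 G)"
      using realization_rel.face[OF ys(1) face(2,3)] xs(1)
      by (intro exI[of _ "((Suc n, ys), simplical_face i t)"]) (simp add: forget_first_def)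
  next
    fix e assume e: "e \<in> topspace (prerealization (E2 G))" "forget_first e = ((Suc n, x), simplical_face i t)"
    then obtain ys where ys: "e = ((Suc n, ys), simplical_face i t)" "ys \<in> simps (E2 G) (Suc n)" "proj2 (Suc n) ys = x"
      by (cases e) (auto simp: forget_first_def topspace_prerealization)
    then show "\<exists>e'. forget_first e' = ((n, ?d' x), t) \<and> (e', e) \<in> realization_rel (E2 G)"
      using realization_rel.face[OF ys(2) face(2,3)] d[OF ys(2)]
      by (intro exI[of _ "((n, ?d ys), t)"]) (simp add: forget_first_def)
  qed
next
  case (degen x n j t)
  interpret E: simplicial_set "E2 G" by (rule simplicial_set_E2)
  let ?s = "sdegen (E2 G) n j" and ?s' = "sdegen (B2 G) n j"
  have s: "?s zs \<in> simps (E2 G) (Suc n) \<and> proj2 (Suc n) (?s zs) = ?s' (proj2 n zs)"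
    if "zs \<in> simps (E2 G) n" for zs
    using simplicial_map_proj2 E.degen_closed that degen by (simp add: simplicial_map_def)
  have eq: "translate G g (Suc n) (?s zs) = ?s (translate G g n zs)"
    if "g \<in> carrier G" "zs \<in> simps (E2 G) n" for g zs
    using simplicial_map_translate that degen by (simp add: simplicial_map_def)
  show ?case
  proof (intro conjI ballI impI)
    fix e assume e: "e \<in> topspace (prerealization (E2 G))" "forget_first e = ((Suc n, ?s' x), t)"
    then obtain xs where xs: "e = ((Suc n, xs), t)" "xs \<in> simps (E2 G) (Suc n)" "proj2 (Suc n) xs = ?s' x"
      by (cases e) (auto simp: forget_first_def topspace_prerealization)
    obtain ys where ys: "ys \<in> simps (E2 G) n" "proj2 n ys = x" "?s ys = xs"
      by (rule lift_by_translation[of n ?s "Suc n" ?s', OF s eq degen(1) xs(2,3)])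
    then show "\<exists>e'. forget_first e' = ((n, x), simplicial_degen j t) \<and> (e, e') \<in> realization_rel (E2 G)"
      using realization_rel.degen[OF ys(1) degen(2,3)] xs(1)
      by (intro exI[of _ "((n, ys), simplicial_degen j t)"]) (simp add: forget_first_def)
  next
    fix e assume e: "e \<in> topspace (prerealization (E2 G))" "forget_first e = ((n, x), simplicial_degen j t)"
    then obtain ys where ys: "e = ((n, ys), simplicial_degen j t)" "ys \<in> simps (E2 G) n" "proj2 n ys = x"
      by (cases e) (auto simp: forget_first_def topspace_prerealization)
    then show "\<exists>e'. forget_first e' = ((Suc n, ?s' x), t) \<and> (e', e) \<in> realization_rel (E2 G)"
      using realization_rel.degen[OF ys(2) degen(2,3)] s[OF ys(2)]
      by (intro exI[of _ "((Suc n, ?s ys), t)"]) (simp add: forget_first_def)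
  qed
next
  case (refl p)
  show ?case
    by (intro conjI ballI impI) (use realization_rel.refl in blast)+
next
  case (sym p q)
  then show ?case
    by (intro conjI ballI impI) (use realization_rel.sym in blast)+
next
  case (trans p q r)
  have top: "e \<in> topspace (prerealization (E2 G)) \<and> e' \<in> topspace (prerealization (E2 G))"
    if "(e, e') \<in> realization_rel (E2 G)" for e e'
    using that simplicial_set.realization_rel_subset[OF simplicial_set_E2] by blast
  show ?case
  proof (intro conjI ballI impI)
    fix e assume "e \<in> topspace (prerealization (E2 G))" "forget_first e = p"
    then obtain e' where e': "forget_first e' = q" "(e, e') \<in> realization_rel (E2 G)"
      using trans.IH(1) by blast
    then obtain e'' where "forget_first e'' = r" "(e', e'') \<in> realization_rel (E2 G)"
      using trans.IH(2) top by blast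
    then show "\<exists>e'. forget_first e' = r \<and> (e, e') \<in> realization_rel (E2 G)"
      using realization_rel.trans[OF e'(2)] by blast
  next
    fix e assume "e \<in> topspace (prerealization (E2 G))" "forget_first e = r"
    then obtain e' where e': "forget_first e' = q" "(e', e) \<in> realization_rel (E2 G)"
      using trans.IH(2) by blast
    then obtain e'' where "forget_first e'' = p" "(e'', e') \<in> realization_rel (E2 G)"
      using trans.IH(1) top by blast
    then show "\<exists>e'. forget_first e' = p \<and> (e', e) \<in> realization_rel (E2 G)"
      using realization_rel.trans[OF _ e'(2)] by blast
  qed
qed

end

section \<open>Simplices as step functions\<close>

text \<open>The coface and codegeneracy maps are written for coordinates, but they insert a zero into or merge two
  entries of any sequence; below they are applied to the sequence of contributions of the single intervals.\<close>

lemma sum_simplicial_degen: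
  "j \<le> n \<Longrightarrow> (\<Sum>k\<le>n. simplicial_degen j a k) = (\<Sum>k\<le>Suc n. a k)"
proof (induction n)
  case (Suc n)
  then show ?case
    by (cases "j = Suc n") (simp_all add: simplicial_degen_def)
qed (simp add: simplicial_degen_def)

lemma sum_simplical_face:
  fixes a :: "nat \<Rightarrow> real"
  shows "i \<le> Suc n \<Longrightarrow> (\<Sum>k\<le>Suc n. simplical_face i a k) = (\<Sum>k\<le>n. a k)"
proof (induction n)
  case 0
  then show ?case by (cases i) (auto simp: simplical_face_def)
next
  case (Suc n)
  show ?case
  proof (cases "i = Suc (Suc n)")
    case True
    then show ?thesis by (simp add: simplical_face_def)
  next
    case False
    then show ?thesis using Suc by (simp add: simplical_face_def)
  qed
qed

lemma simplical_face_apply: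
  "simplical_face i a k = (if k < i then a k else if k = i then 0 else a (k - 1))"
  by (simp add: simplical_face_def)

lemma simplicial_degen_apply:
  "simplicial_degen j a k = (if k < j then a k else if k = j then a j + a (Suc j) else a (Suc k))"
  by (simp add: simplicial_degen_def)

text \<open>A point with barycentric coordinates \<open>t\<close> cuts the unit interval into the intervals from
  \<open>breakpoint t k\<close> to \<open>breakpoint t (Suc k)\<close> of length \<open>t k\<close>.\<close>

definition breakpoint :: "(nat \<Rightarrow> real) \<Rightarrow> nat \<Rightarrow> real" where
  "breakpoint t k = (\<Sum>j<k. t j)"

lemma breakpoint_Suc: "breakpoint t (Suc k) = breakpoint t k + t k"
  by (simp add: breakpoint_def)

lemma breakpoint_face:
  "breakpoint (simplical_face i t) k = breakpoint t (if k \<le> i then k else k - 1)"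
proof (induction k)
  case (Suc k)
  have "k - 1 = j" if "k = Suc j" for j using that by simp
  then show ?case using Suc
    by (cases k) (auto simp: breakpoint_Suc simplical_face_def)
qed (simp add: breakpoint_def)

lemma breakpoint_degen:
  "breakpoint (simplicial_degen j t) k = breakpoint t (if k \<le> j then k else Suc k)"
  by (induction k) (auto simp: breakpoint_Suc simplicial_degen_def, auto simp: breakpoint_def)

primrec partial_product :: "('a, 'm) monoid_scheme \<Rightarrow> 'a list \<Rightarrow> nat \<Rightarrow> 'a" where
  "partial_product G xs 0 = xs ! 0"
| "partial_product G xs (Suc k) = partial_product G xs k \<otimes>\<^bsub>G\<^esub> xs ! Suc k"

text \<open>For $u \le v$ and $c \le d$ this is the length of the intersection of the intervals from \<open>u\<close> to \<open>v\<close> and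
  from \<open>c\<close> to \<open>d\<close>. As a difference of values of one function it is additive over adjacent intervals.\<close>

definition overlap :: "real \<Rightarrow> real \<Rightarrow> real \<Rightarrow> real \<Rightarrow> real" where
  "overlap c d u v = max c (min v d) - max c (min u d)"

text \<open>The total length, within the interval from \<open>c\<close> to \<open>d\<close>, on which the step function of a point has the
  value \<open>h\<close>.\<close>

definition value_length ::
  "('a, 'm) monoid_scheme \<Rightarrow> real \<Rightarrow> real \<Rightarrow> 'a \<Rightarrow> (nat \<times> 'a list) \<times> (nat \<Rightarrow> real) \<Rightarrow> real" where
  "value_length G c d h = (\<lambda>((n, xs), t). \<Sum>k\<le>n.
     if partial_product G xs k = h then overlap c d (breakpoint t k) (breakpoint t (Suc k)) else 0)"

lemma sum_overlap:
  "(\<Sum>k\<le>n. overlap c d (T k) (T (Suc k))) = overlap c d (T 0) (T (Suc n))"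
  by (induction n) (simp_all add: overlap_def)

lemma overlap_nonneg: "u \<le> v \<Longrightarrow> 0 \<le> overlap c d u v"
  by (auto simp: overlap_def)

lemma overlap_le: "c \<le> d \<Longrightarrow> overlap c d u v \<le> d - c"
  by (auto simp: overlap_def)

context group
begin

lemma partial_product_closed:
  "\<lbrakk>set xs \<subseteq> carrier G; k < length xs\<rbrakk> \<Longrightarrow> partial_product G xs k \<in> carrier G"
  by (induction k) (auto simp: nth_carrier)

lemma partial_product_translate:
  assumes "xs \<in> simps (E2 G) n" "g \<in> carrier G" "k \<le> n"
  shows "partial_product G (translate G g n xs) k = g \<otimes> partial_product G xs k"
  using assms(3)
proof (induction k)
  case 0
  then show ?case using assms by (elim E2_cases) (simp add: translate_def)
next
  case (Suc k)
  obtain a as where xs: "xs = a # as" "a \<in> carrier G" "length as = n" "set as \<subseteq> carrier G"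
    using assms(1) by (rule E2_cases)
  then have "translate G g n xs ! Suc k = xs ! Suc k" "partial_product G xs k \<in> carrier G"
    "xs ! Suc k \<in> carrier G"
    using Suc.prems partial_product_closed[of xs k] nth_carrier[of xs "Suc k"]
    by (simp_all add: translate_def)
  then show ?case using Suc assms(2) by (simp add: m_assoc)
qed

lemma partial_product_face:
  assumes "xs \<in> simps (E2 G) (Suc n)" "i \<le> Suc n" "k \<le> n"
  shows "partial_product G (sface (E2 G) (Suc n) i xs) k = partial_product G xs (if k < i then k else Suc k)"
proof -
  have l: "length xs = Suc (Suc n)" "set xs \<subseteq> carrier G" using assms(1) by (simp_all add: simps_E2)
  have face: "sface (E2 G) (Suc n) i xs ! k =
      (if k < i then xs ! k else if k = i then xs ! k \<otimes> xs ! Suc k else xs ! Suc k)" if "k \<le> n" for k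
    using that l assms(2) by (simp add: E2_def nth_butlast nth_mult_at)
  show ?thesis
    using assms(3)
  proof (induction k)
    case 0
    then show ?case using face[of 0] by auto
  next
    case (Suc k)
    have "partial_product G xs k \<in> carrier G"
      using l Suc.prems by (intro partial_product_closed) auto
    then show ?case using Suc face[of "Suc k"] l
      by (auto simp: nth_carrier m_assoc)
  qed
qed

lemma partial_product_degen:
  assumes "xs \<in> simps (E2 G) n" "j \<le> n" "k \<le> Suc n"
  shows "partial_product G (sdegen (E2 G) n j xs) k = partial_product G xs (if k \<le> j then k else k - 1)"
proof -
  have l: "length xs = Suc n" "set xs \<subseteq> carrier G" using assms(1) by (simp_all add: simps_E2)
  have degen: "sdegen (E2 G) n j xs ! k = (if k \<le> j then xs ! k else if k = Suc j then \<one> else xs ! (k - 1))"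
    if "k \<le> Suc n" for k
    using that l assms(2) by (simp add: E2_def nth_insert_one)
  show ?thesis
    using assms(3)
  proof (induction k)
    case 0
    then show ?case using degen[of 0] by simp
  next
    case (Suc k)
    have c: "partial_product G xs k \<in> carrier G"
      using l Suc.prems by (intro partial_product_closed) auto
    consider "k < j" | "k = j" | m where "k = Suc m" "j < k"
      by (metis less_imp_Suc_add linorder_neqE_nat)
    then show ?case
      using Suc degen[of "Suc k"] c by cases auto
  qed
qed

text \<open>A coface map adds an interval of length zero, and a codegeneracy map merges two adjacent intervals on
  which the step function has the same value.\<close>

lemma value_length_invariant:
  assumes "(p, p') \<in> realization_rel (E2 G)"
  shows "value_length G c d h p = value_length G c d h p'"
  using assms
proof (induction rule: realization_rel.induct)
  case (face x n i t)
  let ?a = "\<lambda>k. if partial_product G (sface (E2 G) (Suc n) i x) k = h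
      then overlap c d (breakpoint t k) (breakpoint t (Suc k)) else 0"
  have "value_length G c d h ((Suc n, x), simplical_face i t) = (\<Sum>k\<le>Suc n. simplical_face i ?a k)"
    unfolding value_length_def prod.case
  proof (rule sum.cong[OF HOL.refl])
    fix k assume k: "k \<in> {..Suc n}"
    consider "k < i" | "k = i" | "i < k" by linarith
    then show "(if partial_product G x k = h
       then overlap c d (breakpoint (simplical_face i t) k) (breakpoint (simplical_face i t) (Suc k)) else 0)
       = simplical_face i ?a k"
    proof cases
      case 1
      then show ?thesis using k face partial_product_face[of x n i k]
        by (simp add: breakpoint_face simplical_face_apply)
    next
      case 2
      then show ?thesis by (simp add: breakpoint_face simplical_face_apply overlap_def)
    next
      case 3
      then obtain m where "k = Suc m" by (cases k) auto
      then show ?thesis using 3 k face partial_product_face[of x n i m]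
        by (simp add: breakpoint_face simplical_face_apply)
    qed
  qed
  also have "\<dots> = value_length G c d h ((n, sface (E2 G) (Suc n) i x), t)"
    using sum_simplical_face[OF face(2), of ?a] by (simp add: value_length_def)
  finally show ?case by simp
next
  case (degen x n j t)
  let ?a = "\<lambda>k. if partial_product G (sdegen (E2 G) n j x) k = h
      then overlap c d (breakpoint t k) (breakpoint t (Suc k)) else 0"
  have "value_length G c d h ((n, x), simplicial_degen j t) = (\<Sum>k\<le>n. simplicial_degen j ?a k)"
    unfolding value_length_def prod.case
  proof (rule sum.cong[OF HOL.refl])
    fix k assume k: "k \<in> {..n}"
    show "(if partial_product G x k = h
       then overlap c d (breakpoint (simplicial_degen j t) k) (breakpoint (simplicial_degen j t) (Suc k)) else 0)
       = simplicial_degen j ?a k"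
    proof -
      have pp: "partial_product G (sdegen (E2 G) n j x) m = partial_product G x (if m \<le> j then m else m - 1)"
        if "m \<le> Suc n" for m
        using partial_product_degen[OF degen(1,2) that] .
      consider "k < j" | "k = j" | "j < k" by linarith
      then show ?thesis
        using k degen(2) by cases
          (simp_all add: breakpoint_degen simplicial_degen_apply pp overlap_def del: partial_product.simps(2))
    qed
  qed
  also have "\<dots> = value_length G c d h ((Suc n, sdegen (E2 G) n j x), t)"
    using sum_simplicial_degen[OF degen(2), of ?a] by (simp add: value_length_def)
  finally show ?case by simp
qed auto

lemma continuous_map_value_length:
  "continuous_map (subtopology (powertop_real UNIV) (standard_simplex n)) euclideanreal
     (\<lambda>t. value_length G c d h ((n, xs), t))"
proof -
  have "continuous_map (subtopology (powertop_real UNIV) (standard_simplex n)) euclideanreal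
      (\<lambda>t. if P then overlap c d (breakpoint t k) (breakpoint t (Suc k)) else 0)" for P k
    by (cases P) (auto simp: overlap_def breakpoint_def
      intro!: continuous_intros continuous_map_from_subtopology continuous_map_product_projection)
  then show ?thesis
    unfolding value_length_def prod.case by (intro continuous_map_sum) auto
qed

text \<open>A step function and its translate by $g \ne 1$ have distinct values everywhere, so the two lengths belong
  to disjoint subsets of the interval.\<close>

lemma value_length_disjoint:
  assumes "xs \<in> simps (E2 G) n" "t \<in> standard_simplex n" "g \<in> carrier G" "g \<noteq> \<one>" "c \<le> d"
  shows "value_length G c d h ((n, xs), t) + value_length G c d h ((n, translate G g n xs), t) \<le> d - c"
proof -
  let ?o = "\<lambda>k. overlap c d (breakpoint t k) (breakpoint t (Suc k))"
  have "value_length G c d h ((n, xs), t) + value_length G c d h ((n, translate G g n xs), t)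
    = (\<Sum>k\<le>n. (if partial_product G xs k = h then ?o k else 0) +
        (if g \<otimes> partial_product G xs k = h then ?o k else 0))"
  proof -
    have "value_length G c d h ((n, translate G g n xs), t) =
        (\<Sum>k\<le>n. if g \<otimes> partial_product G xs k = h then ?o k else 0)"
      unfolding value_length_def prod.case
      using assms by (intro sum.cong) (simp_all add: partial_product_translate)
    then show ?thesis by (simp add: value_length_def sum.distrib)
  qed
  also have "\<dots> \<le> (\<Sum>k\<le>n. ?o k)"
  proof (rule sum_mono)
    fix k assume "k \<in> {..n}"
    then have "partial_product G xs k \<in> carrier G"
      using assms(1) by (intro partial_product_closed) (auto simp: simps_E2)
    moreover have "0 \<le> ?o k"
      using assms(2) by (intro overlap_nonneg) (simp add: breakpoint_Suc standard_simplex_def)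
    ultimately show "(if partial_product G xs k = h then ?o k else 0) +
        (if g \<otimes> partial_product G xs k = h then ?o k else 0) \<le> ?o k"
      using assms(3,4) by (auto simp: l_cancel_one)
  qed
  also have "\<dots> \<le> d - c"
    unfolding sum_overlap using assms(5) by (rule overlap_le)
  finally show ?thesis .
qed

text \<open>An interval of positive length exists because the coordinates sum to 1; \<open>c\<close>, \<open>d\<close> and \<open>h\<close> are its endpoints
  and the value there.\<close>

lemma value_length_positive:
  assumes "xs \<in> simps (E2 G) n" "t \<in> standard_simplex n"
  obtains c d h where "c < d" "d - c \<le> value_length G c d h ((n, xs), t)"
proof -
  have t: "\<And>k. 0 \<le> t k" "(\<Sum>k\<le>n. t k) = 1"
    using assms(2) by (auto simp: standard_simplex_def)
  obtain k where k: "k \<le> n" "0 < t k"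
    using t by (metis atMost_iff less_eq_real_def sum.neutral zero_neq_one)
  let ?c = "breakpoint t k" and ?d = "breakpoint t (Suc k)" and ?h = "partial_product G xs k"
  let ?a = "\<lambda>i. if partial_product G xs i = ?h
    then overlap ?c ?d (breakpoint t i) (breakpoint t (Suc i)) else 0"
  have "?a k \<le> (\<Sum>i\<le>n. ?a i)"
    using k t by (intro member_le_sum) (auto intro: overlap_nonneg simp: breakpoint_Suc)
  moreover have "?a k = ?d - ?c"
    using t by (simp add: overlap_def breakpoint_Suc)
  ultimately have le: "?d - ?c \<le> value_length G ?c ?d ?h ((n, xs), t)"
    by (simp only: value_length_def prod.case)
  have "?c < ?d"
    using k by (simp add: breakpoint_Suc)
  then show thesis
    using le by (rule that)
qed

section \<open>The covering of $B(2,G)$ by $E(2,G)$\<close>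

abbreviation E2_space where "E2_space \<equiv> realization (E2 G)"
abbreviation B2_space where "B2_space \<equiv> realization (B2 G)"
abbreviation proj where "proj \<equiv> realization_map (B2 G) proj2"
abbreviation move where "move g \<equiv> realization_map (E2 G) (translate G g)"

lemma proj_cell_point:
  "\<lbrakk>xs \<in> simps (E2 G) n; t \<in> standard_simplex n\<rbrakk> \<Longrightarrow>
   proj (cell_point (E2 G) n xs t) = cell_point (B2 G) n (proj2 n xs) t"
  by (intro realization_map_class simplicial_map_proj2 simplicial_set_E2 simplicial_set_B2)

lemma move_cell_point:
  "\<lbrakk>g \<in> carrier G; xs \<in> simps (E2 G) n; t \<in> standard_simplex n\<rbrakk> \<Longrightarrow>
   move g (cell_point (E2 G) n xs t) = cell_point (E2 G) n (translate G g n xs) t"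
  by (intro realization_map_class simplicial_map_translate simplicial_set_E2)

text \<open>An identification below lifts to one above that starts at a given lift; its end differs from any other
  lift by a translation.\<close>

lemma proj_fibre:
  assumes "C \<in> topspace E2_space" "D \<in> topspace E2_space"
  shows "proj C = proj D \<longleftrightarrow> (\<exists>g \<in> carrier G. D = move g C)"
proof -
  interpret E: simplicial_set "E2 G" by (rule simplicial_set_E2)
  interpret B: simplicial_set "B2 G" by (rule simplicial_set_B2)
  obtain n xs t where C: "xs \<in> simps (E2 G) n" "t \<in> standard_simplex n" "C = cell_point (E2 G) n xs t"
    using assms(1) by (rule E.realization_cases)
  obtain m ys u where D: "ys \<in> simps (E2 G) m" "u \<in> standard_simplex m" "D = cell_point (E2 G) m ys u"
    using assms(2) by (rule E.realization_cases)
  show ?thesis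
  proof
    assume "proj C = proj D"
    then have "cell_point (B2 G) n (proj2 n xs) t = cell_point (B2 G) m (proj2 m ys) u"
      using C D by (simp add: proj_cell_point)
    moreover have "proj2 n xs \<in> simps (B2 G) n"
      using C(1) by (simp add: simps_E2 B2_def proj2_def)
    ultimately have "(((n, proj2 n xs), t), ((m, proj2 m ys), u)) \<in> realization_rel (B2 G)"
      using B.cell_point_eq_iff C(2) by blast
    moreover have "((n, xs), t) \<in> topspace (prerealization (E2 G))"
      using C by (simp add: topspace_prerealization)
    moreover have "forget_first ((n, xs), t) = ((n, proj2 n xs), t)"
      by (simp add: forget_first_def)
    ultimately obtain e' where e': "forget_first e' = ((m, proj2 m ys), u)"
        "(((n, xs), t), e') \<in> realization_rel (E2 G)"
      using realization_rel_lift by blast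
    then obtain zs where zs: "e' = ((m, zs), u)" "proj2 m zs = proj2 m ys"
      by (cases e') (auto simp: forget_first_def)
    have "zs \<in> simps (E2 G) m"
      using e'(2) E.realization_rel_subset by (auto simp: zs topspace_prerealization)
    moreover have "C = cell_point (E2 G) m zs u"
      using E.cell_point_eq_iff[OF C(1,2)] e'(2) C(3) zs(1) by simp
    moreover obtain g where "g \<in> carrier G" "ys = translate G g m zs"
      using translate_transitive[of zs m ys] zs(2) D(1) \<open>zs \<in> simps (E2 G) m\<close> by (auto simp: proj2_def)
    ultimately show "\<exists>g \<in> carrier G. D = move g C"
      using D by (auto simp: move_cell_point)
  next
    assume "\<exists>g \<in> carrier G. D = move g C"
    then show "proj C = proj D"
      using C by (auto simp: move_cell_point proj_cell_point translate_closed proj2_translate)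
  qed
qed

text \<open>The points whose step function has the value \<open>h\<close> on more than half of a fixed interval form an open set.
  If \<open>w\<close> and its translate both belonged to it, their lengths would add up to more than the whole interval.\<close>

lemma move_separated:
  assumes "C \<in> topspace E2_space"
  shows "\<exists>W. openin E2_space W \<and> C \<in> W \<and> (\<forall>g \<in> carrier G. \<forall>w \<in> W. move g w \<in> W \<longrightarrow> g = \<one>)"
proof -
  interpret E: simplicial_set "E2 G" by (rule simplicial_set_E2)
  obtain n xs t where C: "xs \<in> simps (E2 G) n" "t \<in> standard_simplex n" "C = cell_point (E2 G) n xs t"
    using assms by (rule E.realization_cases)
  obtain c d h where cd: "c < d" "d - c \<le> value_length G c d h ((n, xs), t)"
    using C(1,2) by (rule value_length_positive)
  define W where "W = {C \<in> topspace E2_space. \<exists>p \<in> C. (d - c) / 2 < value_length G c d h p}"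
  have W_iff: "cell_point (E2 G) m ys u \<in> W \<longleftrightarrow> (d - c) / 2 < value_length G c d h ((m, ys), u)"
    if "ys \<in> simps (E2 G) m" "u \<in> standard_simplex m" for m ys u
  proof -
    have "((m, ys), u) \<in> cell_point (E2 G) m ys u"
      using that realization_rel.refl[of "((m, ys), u)" "E2 G"] by (simp add: topspace_prerealization)
    moreover have "value_length G c d h p = value_length G c d h ((m, ys), u)"
      if "p \<in> cell_point (E2 G) m ys u" for p
      using value_length_invariant[of "((m, ys), u)" p] that by simp
    ultimately have "(\<exists>p \<in> cell_point (E2 G) m ys u. (d - c) / 2 < value_length G c d h p) \<longleftrightarrow>
        (d - c) / 2 < value_length G c d h ((m, ys), u)"
      by metis
    then show ?thesis
      unfolding W_def using E.cell_point_in_realization[OF that] by blast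
  qed
  have "openin E2_space W"
    unfolding W_def
  proof (rule E.openin_realization_superlevel[where \<phi> = "value_length G c d h"])
    show "value_length G c d h p = value_length G c d h p'" if "(p, p') \<in> realization_rel (E2 G)" for p p'
      using that by (rule value_length_invariant)
  qed (rule continuous_map_value_length)
  moreover have "C \<in> W"
    using cd C by (simp add: W_iff)
  moreover have "g = \<one>" if g: "g \<in> carrier G" "w \<in> W" "move g w \<in> W" for g w
  proof (rule ccontr)
    assume "g \<noteq> \<one>"
    have "w \<in> topspace E2_space" using g(2) by (simp add: W_def)
    then obtain m ys u where w: "ys \<in> simps (E2 G) m" "u \<in> standard_simplex m" "w = cell_point (E2 G) m ys u"
      by (rule E.realization_cases)
    then have "(d - c) / 2 < value_length G c d h ((m, ys), u)"
      "(d - c) / 2 < value_length G c d h ((m, translate G g m ys), u)"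
      using g by (simp_all add: W_iff move_cell_point translate_closed)
    then show False
      using value_length_disjoint[OF w(1,2) g(1) \<open>g \<noteq> \<one>\<close>, of c d h] cd(1) by simp
  qed
  ultimately show ?thesis by blast
qed

lemma free_quotient_E2_B2: "free_quotient G E2_space B2_space proj move"
proof
  interpret E: simplicial_set "E2 G" by (rule simplicial_set_E2)
  show "quotient_map E2_space B2_space proj"
    by (rule quotient_map_realization_map[OF simplicial_map_proj2 simplicial_set_E2 simplicial_set_B2])
      (metis B2_eq_proj2)
  show "continuous_map E2_space E2_space (move g)" if "g \<in> carrier G" for g
    using that by (intro continuous_map_realization_map simplicial_map_translate simplicial_set_E2)
  show "move \<one> C = C" if "C \<in> topspace E2_space" for C
    using that by (rule E.realization_cases) (simp add: move_cell_point translate_one)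
  show "move (g \<otimes> h) C = move g (move h C)"
    if "g \<in> carrier G" "h \<in> carrier G" "C \<in> topspace E2_space" for g h C
    using that(3) by (rule E.realization_cases)
      (simp add: move_cell_point translate_mult translate_closed that(1,2))
  show "proj C = proj D \<longleftrightarrow> (\<exists>g \<in> carrier G. D = move g C)"
    if "C \<in> topspace E2_space" "D \<in> topspace E2_space" for C D
    using that by (rule proj_fibre)
  show "\<exists>W. openin E2_space W \<and> C \<in> W \<and> (\<forall>g \<in> carrier G. \<forall>w \<in> W. move g w \<in> W \<longrightarrow> g = \<one>)"
    if "C \<in> topspace E2_space" for C
    using that by (rule move_separated)
qed

text \<open>The last face of a simplex keeps its first vertex, so repeated passage to the last face leads there.\<close>

lemma path_component_first_vertex:
  assumes "xs \<in> simps (E2 G) n" "t \<in> standard_simplex n" "s \<in> standard_simplex 0"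
  shows "path_component_of E2_space (cell_point (E2 G) n xs t) (cell_point (E2 G) 0 [hd xs] s)"
  using assms(1,2)
proof (induction n arbitrary: xs t)
  case 0
  then have "[hd xs] = xs" by (auto simp: simps_E2 length_Suc_conv)
  then show ?case
    using simplicial_set.path_component_cell[OF simplicial_set_E2 0 assms(3)] by simp
next
  interpret E: simplicial_set "E2 G" by (rule simplicial_set_E2)
  case (Suc n)
  obtain u where u: "u \<in> standard_simplex n" using nonempty_standard_simplex by blast
  let ?ys = "sface (E2 G) (Suc n) (Suc n) xs"
  have "path_component_of E2_space (cell_point (E2 G) (Suc n) xs t) (cell_point (E2 G) n ?ys u)"
    by (rule E.path_component_face[OF Suc.prems(1) order_refl Suc.prems(2) u])
  moreover have "path_component_of E2_space (cell_point (E2 G) n ?ys u) (cell_point (E2 G) 0 [hd ?ys] s)"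
    by (rule Suc.IH[OF E.face_closed[OF Suc.prems(1) order_refl] u])
  moreover have "hd ?ys = hd xs"
    using Suc.prems(1) by (elim E2_cases) (auto simp: E2_def)
  ultimately show ?case
    using path_component_of_trans by fastforce
qed

text \<open>The edge $(a, a^{-1} b)$ joins the vertices \<open>a\<close> and \<open>b\<close>.\<close>

lemma path_connected_E2: "path_connected_space E2_space"
proof -
  interpret E: simplicial_set "E2 G" by (rule simplicial_set_E2)
  obtain s :: "nat \<Rightarrow> real" where s: "s \<in> standard_simplex 0" using nonempty_standard_simplex by blast
  obtain s1 :: "nat \<Rightarrow> real" where s1: "s1 \<in> standard_simplex (Suc 0)" using nonempty_standard_simplex by blast
  have vertices: "path_component_of E2_space (cell_point (E2 G) 0 [a] s) (cell_point (E2 G) 0 [b] s)"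
    if ab: "a \<in> carrier G" "b \<in> carrier G" for a b
  proof -
    let ?e = "[a, inv a \<otimes> b]"
    have e: "?e \<in> simps (E2 G) (Suc 0)" using ab by (auto simp: simps_E2 commuting_tuples_def)
    have "sface (E2 G) (Suc 0) 0 ?e = [b]" "sface (E2 G) (Suc 0) (Suc 0) ?e = [a]"
      using ab by (auto simp: E2_def mult_at_def m_assoc[symmetric])
    then have b: "path_component_of E2_space (cell_point (E2 G) (Suc 0) ?e s1) (cell_point (E2 G) 0 [b] s)"
      and a: "path_component_of E2_space (cell_point (E2 G) (Suc 0) ?e s1) (cell_point (E2 G) 0 [a] s)"
      using E.path_component_face[OF e le0 s1 s] E.path_component_face[OF e order_refl s1 s] by simp_all
    show ?thesis
      by (rule path_component_of_trans[OF path_component_of_sym[OF a] b])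
  qed
  have "path_component_of E2_space C D" if CD: "C \<in> topspace E2_space" "D \<in> topspace E2_space" for C D
  proof -
    obtain n xs t where C: "xs \<in> simps (E2 G) n" "t \<in> standard_simplex n" "C = cell_point (E2 G) n xs t"
      using CD(1) by (rule E.realization_cases)
    obtain m ys u where D: "ys \<in> simps (E2 G) m" "u \<in> standard_simplex m" "D = cell_point (E2 G) m ys u"
      using CD(2) by (rule E.realization_cases)
    have "hd xs \<in> carrier G" "hd ys \<in> carrier G"
      using C(1) D(1) by (auto elim!: E2_cases)
    then have "path_component_of E2_space C (cell_point (E2 G) 0 [hd ys] s)"
      unfolding C(3) by (rule path_component_of_trans[OF path_component_first_vertex[OF C(1,2) s] vertices])
    moreover have "path_component_of E2_space (cell_point (E2 G) 0 [hd ys] s) D"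
      unfolding D(3) by (rule path_component_of_sym[OF path_component_first_vertex[OF D(1,2) s]])
    ultimately show ?thesis
      by (rule path_component_of_trans)
  qed
  then show ?thesis
    by (simp add: path_connected_space_iff_path_component)
qed

theorem H1_proj_surjective_iff_perfect:
  "H1_proj G ` carrier (homology_group 1 E2_space) = carrier (homology_group 1 B2_space) \<longleftrightarrow>
   derived G (carrier G) = carrier G"
proof -
  interpret free_quotient G E2_space B2_space proj move by (rule free_quotient_E2_B2)
  obtain s :: "nat \<Rightarrow> real" where "s \<in> standard_simplex 0" using nonempty_standard_simplex by blast
  moreover have "[\<one>] \<in> simps (E2 G) 0" by (simp add: simps_E2 commuting_tuples_def)
  ultimately have "topspace E2_space \<noteq> {}"
    using simplicial_set.cell_point_in_realization[OF simplicial_set_E2] by blast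
  then show ?thesis
    unfolding H1_proj_def by (rule homology_surjective_iff_perfect[OF path_connected_E2])
qed

section \<open>Perfect groups and solvability\<close>

lemma solvable_perfect_imp_trivial:
  assumes "solvable G" "derived G (carrier G) = carrier G"
  shows "carrier G = {\<one>}"
proof -
  have "(derived G ^^ n) (carrier G) = carrier G" for n
    by (induction n) (simp_all add: assms(2))
  then show ?thesis
    using assms(1) solvable_iff_trivial_derived_seq by auto
qed

text \<open>In a finite group the derived series decreases strictly until it reaches a perfect subgroup.\<close>

lemma solvable_if_no_perfect_subgroup:
  assumes fin: "finite (carrier G)"
    and no_perfect: "\<And>H. \<lbrakk>subgroup H G; derived G H = H\<rbrakk> \<Longrightarrow> H = {\<one>}"
  shows "solvable G"
proof -
  have "\<exists>n. (derived G ^^ n) H = {\<one>}" if "subgroup H G" for H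
    using that
  proof (induction "card H" arbitrary: H rule: less_induct)
    case less
    show ?case
    proof (cases "derived G H = H")
      case True
      then have "(derived G ^^ 0) H = {\<one>}" using no_perfect[OF less.prems] by simp
      then show ?thesis by blast
    next
      case False
      have "derived G H \<subset> H"
        using False derived_incl[OF order_refl less.prems] by blast
      moreover have "finite H"
        using fin subgroup.subset[OF less.prems] finite_subset by blast
      ultimately have "card (derived G H) < card H" by (simp add: psubset_card_mono)
      moreover have "subgroup (derived G H) G"
        using derived_is_subgroup subgroup.subset[OF less.prems] by blast
      ultimately obtain n where "(derived G ^^ n) (derived G H) = {\<one>}"
        using less.hyps by blast
      then have "(derived G ^^ Suc n) H = {\<one>}" by (simp add: funpow_swap1)
      then show ?thesis by blast
    qed
  qed
  then show ?thesis
    using solvable_iff_trivial_derived_seq subgroup_self by blast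
qed

end

theorem proposition7p2:
  shows "(\<forall>G :: 'a monoid. group G \<and> finite (carrier G) \<and> odd (order G) \<longrightarrow> solvable G) \<longleftrightarrow>
         (\<forall>G :: 'a monoid. group G \<and> finite (carrier G) \<and> odd (order G) \<and> carrier G \<noteq> {\<one>\<^bsub>G\<^esub>} \<longrightarrow>
            \<not> H1_proj G ` carrier (homology_group 1 (realization (E2 G)))
              = carrier (homology_group 1 (realization (B2 G))))"
    (is "(\<forall>G. ?odd G \<longrightarrow> solvable G) \<longleftrightarrow> ?R")
proof
  assume FT: "\<forall>G :: 'a monoid. ?odd G \<longrightarrow> solvable G"
  show ?R
  proof (intro allI impI notI, elim conjE)
    fix G :: "'a monoid"
    assume G: "group G" "finite (carrier G)" "odd (order G)" "carrier G \<noteq> {\<one>\<^bsub>G\<^esub>}"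
      and surj: "H1_proj G ` carrier (homology_group 1 (realization (E2 G)))
              = carrier (homology_group 1 (realization (B2 G)))"
    then have "derived G (carrier G) = carrier G"
      by (simp add: group.H1_proj_surjective_iff_perfect)
    then show False
      using group.solvable_perfect_imp_trivial[OF G(1)] FT G by blast
  qed
next
  assume R: ?R
  show "\<forall>G :: 'a monoid. ?odd G \<longrightarrow> solvable G"
  proof (intro allI impI, elim conjE)
    fix G :: "'a monoid"
    assume G: "group G" "finite (carrier G)" "odd (order G)"
    interpret group G by fact
    show "solvable G"
    proof (rule solvable_if_no_perfect_subgroup[OF G(2)])
      fix H assume H: "subgroup H G" "derived G H = H"
      \<comment> \<open>A perfect subgroup has odd order by Lagrange, and for it the map is onto, so it must be trivial.\<close>
      let ?H = "G\<lparr>carrier := H\<rparr>"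
      interpret H: group ?H using H(1) by (rule subgroup_imp_group)
      have "derived ?H (carrier ?H) = carrier ?H"
        using derived_consistent[OF order_refl H(1)] H(2) by simp
      then have "H1_proj ?H ` carrier (homology_group 1 (realization (E2 ?H)))
              = carrier (homology_group 1 (realization (B2 ?H)))"
        using H.H1_proj_surjective_iff_perfect by blast
      moreover have "finite (carrier ?H)"
        using G(2) subgroup.subset[OF H(1)] finite_subset by auto
      moreover have "card (rcosets\<^bsub>G\<^esub> H) * card H = order G"
        using H(1) by (rule lagrange)
      then have "odd (card H)"
        using G(3) by (metis even_mult_iff)
      then have "odd (order ?H)"
        by (simp add: order_def)
      ultimately have "carrier ?H = {\<one>\<^bsub>?H\<^esub>}"
        using R H.group_axioms by blast
      then show "H = {\<one>\<^bsub>G\<^esub>}" by simp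
    qed
  qed
qed

end
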